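(* Let $q+1<p\le 2$, and let $a\ge q(1-q)$ in the case $p=2$. Assume that there exists $K_1>0$ such that $t\,\dot\delta(t)<K_1\,\delta(t)$ for all $t$ big enough. Let $x:[t_0,+\infty)\to\mathcal X$ be the unique global solution of the system (DS) given in the context. Then $x(t)$ converges weakly to an element of $\operatorname{argmin} g$ as $t\to+\infty$. Further, for any $x^*\in\operatorname{argmin} g$, $$g(x(t))-g(x^* )=o\left(\frac{1}{\delta(t)t^{2q}}\right)\quad\text{and}\quad \|\dot x(t)+\beta\nabla g(x(t))\|=o\left(\frac{1}{t^q}\right),\quad\text{as } t\to+\infty.$$
   Context: $\mathcal X$ is a real Hilbert space with inner product $\langle\cdot,\cdot\rangle$ and norm $\|\cdot\|$. $g:\mathcal X\to\mathbb R$ is a convex, twice differentiable function whose set of minimizers $\operatorname{argmin} g$ is nonempty. The parameters satisfy $t_0>0$, $\alpha,\beta,a,p>0$, $0<q<1$. The time scaling function $\delta:[t_0,+\infty)\to(0,+\infty)$ is differentiable and non-decreasing with $\lim_{t\to+\infty}\delta(t)=+\infty$. The system (DS) is $$\ddot x(t)+\frac{\alpha}{t^q}\dot x(t)+\beta\nabla^2 g(x(t))\dot x(t)+\delta(t)\nabla g(x(t))+\frac{a}{t^p}x(t)=0,\qquad t\ge t_0.$$ A (strong) global solution is a function $x:[t_0,+\infty)\to\mathcal X$ with $x$ and $\dot x$ locally absolutely continuous, satisfying the equation for almost every $t\ge t_0$, with prescribed initial data $(x(t_0),\dot x(t_0))\in\mathcal X\times\mathcal X$. *)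

theory Defs
  imports "HOL-Analysis.Analysis" "HOL-Library.Landau_Symbols"
begin

definition argmin :: "('a \<Rightarrow> real) \<Rightarrow> 'a set" where
  "argmin g = {z. is_arg_min g (\<lambda>_. True) z}"

text \<open>On a Hilbert space a Frechet derivative is represented by a unique gradient (Riesz), so
  the description below is proper wherever \<open>g\<close> is differentiable.\<close>

definition grad :: "('a::real_inner \<Rightarrow> real) \<Rightarrow> 'a \<Rightarrow> 'a" where
  "grad g x = (THE D. GDERIV g x :> D)"

definition hessian :: "('a::real_inner \<Rightarrow> real) \<Rightarrow> 'a \<Rightarrow> 'a \<Rightarrow> 'a" where
  "hessian g x = frechet_derivative (grad g) (at x)"

definition twice_differentiable :: "('a::real_inner \<Rightarrow> real) \<Rightarrow> bool" where
  "twice_differentiable g \<longleftrightarrow>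
     (\<forall>x. g differentiable (at x)) \<and> (\<forall>x. grad g differentiable (at x))"

definition weakly_tendsto :: "('b \<Rightarrow> 'a::real_normed_vector) \<Rightarrow> 'a \<Rightarrow> 'b filter \<Rightarrow> bool" where
  "weakly_tendsto x l F \<longleftrightarrow>
     (\<forall>f :: 'a \<Rightarrow> real. bounded_linear f \<longrightarrow> ((\<lambda>t. f (x t)) \<longlongrightarrow> f l) F)"

text \<open>A finite family of nonoverlapping subintervals is encoded by the set of its pairs of
  endpoints; degenerate pairs contribute nothing to either sum.\<close>

definition abs_continuous_on :: "real \<Rightarrow> real \<Rightarrow> (real \<Rightarrow> 'a::real_normed_vector) \<Rightarrow> bool" where
  "abs_continuous_on a b f \<longleftrightarrow>
     (\<forall>\<epsilon>>0. \<exists>\<eta>>0. \<forall>D :: (real \<times> real) set.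
        finite D \<and> (\<forall>(u, v)\<in>D. a \<le> u \<and> u \<le> v \<and> v \<le> b) \<and>
        disjoint_family_on (\<lambda>(u, v). {u<..<v}) D \<and> (\<Sum>(u, v)\<in>D. v - u) < \<eta>
        \<longrightarrow> (\<Sum>(u, v)\<in>D. norm (f v - f u)) < \<epsilon>)"

definition locally_abs_continuous_from :: "real \<Rightarrow> (real \<Rightarrow> 'a::real_normed_vector) \<Rightarrow> bool" where
  "locally_abs_continuous_from t0 f \<longleftrightarrow> (\<forall>T\<ge>t0. abs_continuous_on t0 T f)"

text \<open>Derivative of a trajectory living on \<open>[t0, \<infinity>)\<close>; one-sided at \<open>t0\<close>.\<close>

definition dot :: "real \<Rightarrow> (real \<Rightarrow> 'a::real_normed_vector) \<Rightarrow> real \<Rightarrow> 'a" where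
  "dot t0 x t = vector_derivative x (at t within {t0..})"

text \<open>Differentiability of \<open>x\<close> at every point of \<open>[t0, \<infinity>)\<close> is no extra demand: \<open>x\<close> is the
  integral of its derivative, which is (locally absolutely) continuous. Existence of the second
  derivative is only required almost everywhere, as part of satisfying the equation.\<close>

definition global_solution ::
  "real \<Rightarrow> real \<Rightarrow> real \<Rightarrow> real \<Rightarrow> real \<Rightarrow> real \<Rightarrow> (real \<Rightarrow> real) \<Rightarrow> ('a::real_inner \<Rightarrow> real) \<Rightarrow>
   'a \<Rightarrow> 'a \<Rightarrow> (real \<Rightarrow> 'a) \<Rightarrow> bool" where
  "global_solution t0 \<alpha> q \<beta> a p \<delta> g u0 v0 x \<longleftrightarrow>
     (\<forall>t\<ge>t0. x differentiable (at t within {t0..})) \<and>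
     locally_abs_continuous_from t0 x \<and>
     locally_abs_continuous_from t0 (dot t0 x) \<and>
     (AE t in lebesgue. t \<ge> t0 \<longrightarrow>
        dot t0 x differentiable (at t within {t0..}) \<and>
        dot t0 (dot t0 x) t + (\<alpha> / t powr q) *\<^sub>R dot t0 x t
          + \<beta> *\<^sub>R hessian g (x t) (dot t0 x t)
          + \<delta> t *\<^sub>R grad g (x t) + (a / t powr p) *\<^sub>R x t = 0) \<and>
     x t0 = u0 \<and> dot t0 x t0 = v0"

end

theory Submission
  imports Defs
begin

text \<open>Put \<open>u = x' + \<beta> \<nabla>g(x)\<close>. By the equation the almost everywhere derivative of \<open>u\<close> is continuous,
  so \<open>u\<close> is continuously differentiable. For \<open>z \<in> argmin g\<close> and \<open>0 < b < \<alpha>\<close> the energy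
  \<open>E\<^sub>b = (t\<^sup>2\<^sup>q \<delta> + (\<alpha> - b) \<beta> t\<^sup>q - 2 q \<beta> t\<^sup>2\<^sup>q\<^sup>-\<^sup>1) (g(x) - g(z)) + a t\<^sup>2\<^sup>q\<^sup>-\<^sup>p \<parallel>x\<parallel>\<^sup>2 / 2
     + \<parallel>b (x - z) + t\<^sup>q u\<parallel>\<^sup>2 / 2 + b (\<alpha> - b - q t\<^sup>q\<^sup>-\<^sup>1) \<parallel>x - z\<parallel>\<^sup>2 / 2\<close>
  satisfies \<open>E\<^sub>b' \<le> C t\<^sup>q\<^sup>-\<^sup>p - \<kappa> t\<^sup>-\<^sup>q Q\<close> eventually, where
  \<open>Q = t\<^sup>2\<^sup>q \<delta> (g(x) - g(z)) + t\<^sup>2\<^sup>q \<parallel>u\<parallel>\<^sup>2 / 2\<close>. As \<open>p - q > 1\<close>, \<open>E\<^sub>b\<close> converges. Being affine in \<open>b\<close>, it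
  converges coefficientwise: the constant coefficient is \<open>Q\<close> up to a null function, so \<open>Q\<close>
  converges, and its limit is \<open>0\<close> because \<open>t\<^sup>-\<^sup>q\<close> is not integrable; this gives both rates. The slope
  is then \<open>\<alpha> \<parallel>x - z\<parallel>\<^sup>2 / 2\<close> up to a null function, so \<open>\<parallel>x - z\<parallel>\<close> converges and Opial's argument yields
  weak convergence.\<close>

section \<open>The fundamental theorem of calculus for absolutely continuous functions\<close>

text \<open>Passes from divisions to the sets of endpoint pairs that
  \<open>abs_continuous_on\<close> speaks of. Different members can share an interval only if its
  interior is empty; the interval is then a single point, which is also both tags. So no two members
  yield the same pair, and sums can be reindexed.\<close>

lemma disjoint_family_on_tagged_intervals:
  fixes p :: "(real \<times> real set) set"
  assumes p: "p tagged_partial_division_of cbox a b"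
  shows "inj_on (\<lambda>(x, K). (Inf K, Sup K)) p"
    and "disjoint_family_on (\<lambda>(u, v). {u<..<v}) ((\<lambda>(x, K). (Inf K, Sup K)) ` p)"
proof -
  have K: "\<exists>u v. K = {u..v} \<and> u \<le> v \<and> u \<le> x \<and> x \<le> v \<and> Inf K = u \<and> Sup K = v"
    if xK: "(x, K) \<in> p" for x K
  proof -
    obtain u v where "K = cbox u v"
      using tagged_partial_division_ofD(4)[OF p xK] by blast
    moreover have "x \<in> K"
      using tagged_partial_division_ofD(2)[OF p xK] .
    ultimately show ?thesis by (intro exI[of _ u] exI[of _ v]) auto
  qed
  have int: "interior K1 \<inter> interior K2 = {}" if "(x1, K1) \<in> p" "(x2, K2) \<in> p" "(x1, K1) \<noteq> (x2, K2)" for x1 K1 x2 K2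
    using tagged_partial_division_ofD(5)[OF p that] .
  show inj: "inj_on (\<lambda>(x, K). (Inf K, Sup K)) p"
  proof (rule inj_onI, clarify)
    fix x1 K1 x2 K2
    assume 1: "(x1, K1) \<in> p" "(x2, K2) \<in> p" and eq: "Inf K1 = Inf K2" "Sup K1 = Sup K2"
    obtain u v where uv: "K1 = {u..v}" "u \<le> v" "u \<le> x1" "x1 \<le> v" "Inf K1 = u" "Sup K1 = v"
      using K[OF 1(1)] by auto
    obtain u' v' where uv': "K2 = {u'..v'}" "u' \<le> x2" "x2 \<le> v'" "Inf K2 = u'" "Sup K2 = v'"
      using K[OF 1(2)] by auto
    have KK: "K1 = K2" using uv uv' eq by auto
    show "x1 = x2 \<and> K1 = K2"
    proof (rule ccontr)
      assume n: "\<not> (x1 = x2 \<and> K1 = K2)"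
      then have "interior K1 = {}" using int[OF 1] KK by auto
      then have "u = v" using uv by auto
      then show False using n KK uv uv' eq by auto
    qed
  qed
  show "disjoint_family_on (\<lambda>(u, v). {u<..<v}) ((\<lambda>(x, K). (Inf K, Sup K)) ` p)"
    unfolding disjoint_family_on_def
  proof (intro ballI impI)
    fix s s' assume "s \<in> (\<lambda>(x, K). (Inf K, Sup K)) ` p" "s' \<in> (\<lambda>(x, K). (Inf K, Sup K)) ` p" "s \<noteq> s'"
    then obtain x1 K1 x2 K2 where 1: "(x1, K1) \<in> p" "(x2, K2) \<in> p"
      and s: "s = (Inf K1, Sup K1)" "s' = (Inf K2, Sup K2)" and ne: "K1 \<noteq> K2"
      by auto
    have "interior K1 \<inter> interior K2 = {}" using int[OF 1] ne by auto
    then show "(case s of (u, v) \<Rightarrow> {u<..<v}) \<inter> (case s' of (u, v) \<Rightarrow> {u<..<v}) = {}"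
      unfolding s using K[OF 1(1)] K[OF 1(2)] by (metis case_prod_conv interior_atLeastAtMost_real)
  qed
qed

text \<open>Henstock's argument. At tags outside \<open>N\<close> the derivative controls the
  increment of \<open>A\<close>; intervals tagged in \<open>N\<close> lie in an open set of measure
  below \<open>\<eta>\<close>, so absolute continuity bounds the sum of their increments.\<close>

lemma has_integral_derivative_abs_continuous:
  fixes A :: "real \<Rightarrow> 'a::real_normed_vector"
  assumes ac: "abs_continuous_on a b A" and ab: "a \<le> b" and N: "negligible N"
    and deriv: "\<And>t. t \<in> {a..b} - N \<Longrightarrow> (A has_vector_derivative h t) (at t within {a..b})"
  shows "(h has_integral (A b - A a)) {a..b}"
proof -
  define k where "k t = (if t \<in> N then 0 else h t)" for t
  have "(k has_integral (A b - A a)) {a..b}"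
    unfolding has_integral_real
  proof (intro allI impI)
    fix e :: real assume e: "e > 0"
    \<comment> \<open>The summand 1 keeps \<open>c\<close> positive when
      \<open>a = b\<close>.\<close>
    define c where "c = 1 + b - a"
    define e' where "e' = e / (2 * c)"
    have c: "c > 0" "b - a < c" using ab by (auto simp: c_def)
    have e': "e' > 0"
      using e c by (simp add: e'_def)
    have "e' * (b - a) < e' * c"
      using e' c by simp
    also have "\<dots> = e / 2"
      using c by (simp add: e'_def)
    finally have e'_less: "e' * (b - a) < e / 2" .
    have "e / 2 > 0" using e by simp
    from ac[unfolded abs_continuous_on_def, THEN spec, THEN mp, OF this]
    obtain \<eta> where \<eta>: "\<eta> > 0" and small: "\<forall>D. finite D \<and> (\<forall>(u, v)\<in>D. a \<le> u \<and> u \<le> v \<and> v \<le> b) \<and>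
        disjoint_family_on (\<lambda>(u, v). {u<..<v}) D \<and> (\<Sum>(u, v)\<in>D. v - u) < \<eta>
        \<longrightarrow> (\<Sum>(u, v)\<in>D. norm (A v - A u)) < e / 2"
      by (elim exE conjE)
    have Nm: "N \<in> lmeasurable" "measure lebesgue N = 0"
      using N by (auto simp: negligible_imp_measurable negligible_imp_measure0)
    obtain U where U: "open U" "N \<subseteq> U" "U - N \<in> lmeasurable" "emeasure lebesgue (U - N) < ennreal \<eta>"
      using sets_lebesgue_outer_open[of N \<eta>] Nm(1) \<eta> by auto
    have U': "U \<in> lmeasurable" "measure lebesgue U < \<eta>"
    proof -
      have eq: "U = (U - N) \<union> N" using U by auto
      show "U \<in> lmeasurable" by (subst eq) (intro fmeasurable.Un U Nm)
      have "measure lebesgue U \<le> measure lebesgue (U - N) + measure lebesgue N"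
        by (subst (1) eq, rule measure_Un_le) (use U Nm in auto)
      moreover have "measure lebesgue (U - N) < \<eta>"
        using U(3,4) \<eta> by (simp add: emeasure_eq_measure2 ennreal_less_iff)
      ultimately show "measure lebesgue U < \<eta>" using Nm by simp
    qed
    have "\<exists>\<gamma>. open \<gamma> \<and> t \<in> \<gamma> \<and> (if t \<in> N then \<gamma> \<subseteq> U else
          t \<in> {a..b} \<longrightarrow> (\<forall>y\<in>{a..b} \<inter> \<gamma>. norm (A y - A t - (y - t) *\<^sub>R k t) \<le> e' * norm (y - t)))" for t
    proof (cases "t \<in> N")
      case True then show ?thesis using U by auto
    next
      case False
      show ?thesis
      proof (cases "t \<in> {a..b}")
        case True
        obtain d where d: "d > 0" "\<forall>y\<in>{a..b}. norm (y - t) < d \<longrightarrow> norm (A y - A t - (y - t) *\<^sub>R h t) \<le> e' * norm (y - t)"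
          using deriv[of t] True False e' unfolding has_vector_derivative_def has_derivative_within_alt by blast
        then show ?thesis using False
          by (intro exI[of _ "ball t d"]) (auto simp: k_def dist_norm norm_minus_commute)
      qed (use False in auto)
    qed
    then obtain \<gamma> where \<gamma>: "\<And>t. open (\<gamma> t)" "\<And>t. t \<in> \<gamma> t" "\<And>t. t \<in> N \<Longrightarrow> \<gamma> t \<subseteq> U"
      "\<And>t y. \<lbrakk>t \<notin> N; t \<in> {a..b}; y \<in> {a..b}; y \<in> \<gamma> t\<rbrakk> \<Longrightarrow> norm (A y - A t - (y - t) *\<^sub>R k t) \<le> e' * norm (y - t)"
      by (metis IntI)
    show "\<exists>\<gamma>. gauge \<gamma> \<and> (\<forall>\<D>. \<D> tagged_division_of {a..b} \<and> \<gamma> fine \<D> \<longrightarrow>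
             norm ((\<Sum>(x, K)\<in>\<D>. measure lborel K *\<^sub>R k x) - (A b - A a)) < e)"
    proof (intro exI[of _ \<gamma>] conjI allI impI; (elim conjE)?)
      show "gauge \<gamma>" using \<gamma> by (auto simp: gauge_def)
      fix p assume p: "p tagged_division_of {a..b}" and fine: "\<gamma> fine p"
      define pN where "pN = {xK \<in> p. fst xK \<in> N}"
      have fin: "finite p" using p by blast
      have finN: "finite pN" using fin by (auto simp: pN_def)
      have pp: "p tagged_partial_division_of cbox a b"
        using p unfolding tagged_division_of_def by simp
      have ppN: "pN tagged_partial_division_of cbox a b"
        using tagged_partial_division_subset[OF pp] by (auto simp: pN_def)
      have K: "\<exists>u v. K = {u..v} \<and> u \<le> t \<and> t \<le> v \<and> a \<le> u \<and> v \<le> b \<and> Inf K = u \<and> Sup K = v \<and> measure lborel K = v - u"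
        if tK: "(t, K) \<in> p" for t K
      proof -
        obtain u v where "K = cbox u v"
          using tagged_partial_division_ofD(4)[OF pp tK] by blast
        moreover have "t \<in> K" "K \<subseteq> cbox a b"
          using tagged_partial_division_ofD(2,3)[OF pp tK] .
        ultimately show ?thesis by (intro exI[of _ u] exI[of _ v]) auto
      qed
      have cont: "(\<Sum>(t, K)\<in>pN. Sup K - Inf K) < \<eta>"
      proof -
        have "(\<Sum>(t, K)\<in>pN. Sup K - Inf K) = (\<Sum>(t, K)\<in>pN. measure lborel K)"
        proof (rule sum.cong, safe)
          fix t K' assume "(t, K') \<in> pN"
          then have "(t, K') \<in> p" by (simp add: pN_def)
          from K[OF this] show "Sup K' - Inf K' = measure lborel K'" by auto
        qed
        also have "\<dots> = sum (measure lborel) (snd ` pN)"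
        proof -
          \<comment> \<open>An interval carrying two different tags has empty interior and measure
            0, so summing over intervals instead of tagged intervals loses nothing.\<close>
          have "sum (measure lborel) (snd ` pN) = sum (measure lborel \<circ> snd) pN"
          proof (rule sum.reindex_nontrivial[OF finN])
            fix s s' assume s: "s \<in> pN" "s' \<in> pN" "s \<noteq> s'" "snd s = snd s'"
            obtain x1 K1 where 1: "s = (x1, K1)" by fastforce
            obtain x2 where 2: "s' = (x2, K1)" using s(4) 1 by (cases s') auto
            have "interior K1 = {}" using tagged_partial_division_ofD(5)[OF ppN] s 1 2 by blast
            moreover obtain u v where "K1 = cbox u v" using tagged_partial_division_ofD(4)[OF ppN] s 1 by blast
            ultimately show "measure lborel (snd s) = 0" using 1 by (simp add: content_eq_0_interior)
          qed
          then show ?thesis by (simp add: case_prod_unfold comp_def)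
        qed
        also have "\<dots> = sum (measure lebesgue) (snd ` pN)"
        proof (rule sum.cong, safe)
          fix t K' assume "(t, K') \<in> pN"
          then have "(t, K') \<in> p" by (simp add: pN_def)
          then obtain u v where "K' = {u..v}" using K by blast
          then show "measure lborel (snd (t, K')) = measure lebesgue (snd (t, K'))" by simp
        qed
        also have "\<dots> = measure lebesgue (\<Union>(snd ` pN))"
          using content_division[OF partial_division_of_tagged_division[OF ppN]] by simp
        also have "\<dots> \<le> measure lebesgue U"
        proof (rule measure_mono_fmeasurable)
          show "\<Union>(snd ` pN) \<subseteq> U"
            using fine \<gamma>(3) unfolding fine_def pN_def by fastforce
          show "\<Union>(snd ` pN) \<in> sets lebesgue"
            using lmeasurable_division[OF partial_division_of_tagged_division[OF ppN]] by auto
        qed (fact U')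
        finally show ?thesis using U' by simp
      qed
      have sN: "(\<Sum>(t, K)\<in>pN. norm (A (Sup K) - A (Inf K))) < e / 2"
      proof -
        have "(\<Sum>(u, v)\<in>(\<lambda>(x, K). (Inf K, Sup K)) ` pN. norm (A v - A u)) < e / 2"
        proof (intro small[THEN spec, THEN mp] conjI)
          show "\<forall>(u, v)\<in>(\<lambda>(x, K). (Inf K, Sup K)) ` pN. a \<le> u \<and> u \<le> v \<and> v \<le> b"
          proof safe
            fix t K' assume "(t, K') \<in> pN"
            then have "(t, K') \<in> p" by (simp add: pN_def)
            from K[OF this] show "a \<le> Inf K'" "Inf K' \<le> Sup K'" "Sup K' \<le> b" by auto
          qed
          show "(\<Sum>(u, v)\<in>(\<lambda>(x, K). (Inf K, Sup K)) ` pN. v - u) < \<eta>"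
            using cont by (subst sum.reindex[OF disjoint_family_on_tagged_intervals(1)[OF ppN]])
              (simp add: case_prod_unfold comp_def)
        qed (use disjoint_family_on_tagged_intervals(2)[OF ppN] finN in auto)
        then show ?thesis
          by (subst (asm) sum.reindex[OF disjoint_family_on_tagged_intervals(1)[OF ppN]])
            (simp add: case_prod_unfold comp_def)
      qed
      have each: "norm (measure lborel K *\<^sub>R k t - (A (Sup K) - A (Inf K)))
          \<le> e' * (Sup K - Inf K) + (if t \<in> N then norm (A (Sup K) - A (Inf K)) else 0)"
        if tK: "(t, K) \<in> p" for t K
      proof -
        obtain u v where uv: "K = {u..v}" "u \<le> t" "t \<le> v" "a \<le> u" "v \<le> b" "Inf K = u" "Sup K = v" "measure lborel K = v - u"
          using K[OF tK] by blast
        show ?thesis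
        proof (cases "t \<in> N")
          case True then show ?thesis using uv e' by (simp add: k_def norm_minus_commute)
        next
          case False
          have "K \<subseteq> \<gamma> t" using fine tK by blast
          then have mem: "u \<in> \<gamma> t" "v \<in> \<gamma> t" using uv by auto
          \<comment> \<open>The tag lies between the endpoints, so the two errors, both measured
            from \<open>t\<close>, add up to \<open>e' * (v - u)\<close>.\<close>
          have "norm (A u - A t - (u - t) *\<^sub>R k t) \<le> e' * norm (u - t)"
            by (rule \<gamma>(4)[OF False]) (use uv mem in auto)
          moreover have "norm (A v - A t - (v - t) *\<^sub>R k t) \<le> e' * norm (v - t)"
            by (rule \<gamma>(4)[OF False]) (use uv mem in auto)
          ultimately have "norm ((A u - A t - (u - t) *\<^sub>R k t) - (A v - A t - (v - t) *\<^sub>R k t))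
              \<le> e' * norm (u - t) + e' * norm (v - t)"
            by (rule order_trans[OF norm_triangle_ineq4 add_mono])
          moreover have "(v - u) *\<^sub>R k t - (A v - A u)
            = (A u - A t - (u - t) *\<^sub>R k t) - (A v - A t - (v - t) *\<^sub>R k t)"
            by (simp add: algebra_simps)
          ultimately have "norm ((v - u) *\<^sub>R k t - (A v - A u)) \<le> e' * norm (u - t) + e' * norm (v - t)"
            by (simp only:)
          also have "\<dots> = e' * (v - u)" using uv by (simp add: algebra_simps)
          finally show ?thesis using False uv by simp
        qed
      qed
      have "(\<Sum>(x, K)\<in>p. measure lborel K *\<^sub>R k x) - (A b - A a)
          = (\<Sum>(x, K)\<in>p. measure lborel K *\<^sub>R k x - (A (Sup K) - A (Inf K)))"
        using additive_tagged_division_1[OF ab p, of A] by (simp add: sum_subtractf case_prod_unfold)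
      then have "norm ((\<Sum>(x, K)\<in>p. measure lborel K *\<^sub>R k x) - (A b - A a))
          \<le> (\<Sum>(t, K)\<in>p. e' * (Sup K - Inf K) + (if t \<in> N then norm (A (Sup K) - A (Inf K)) else 0))"
        using each by (auto intro!: sum_norm_le)
      also have "\<dots> = e' * (\<Sum>(t, K)\<in>p. Sup K - Inf K) + (\<Sum>(t, K)\<in>pN. norm (A (Sup K) - A (Inf K)))"
        unfolding pN_def using fin
        by (simp add: case_prod_unfold sum.distrib sum_distrib_left sum.inter_filter)
      also have "\<dots> < e"
        using additive_tagged_division_1[OF ab p, of "\<lambda>x. x"] sN e'_less by simp
      finally show "norm ((\<Sum>(x, K)\<in>p. measure lborel K *\<^sub>R k x) - (A b - A a)) < e" .
    qed
  qed
  then show ?thesis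
    by (rule has_integral_spike[OF N, rotated]) (auto simp: k_def)
qed

section \<open>Hilbert space preliminaries\<close>

text \<open>By the parallelogram identity the distance is controlled by the gap between the norms of
  the points and that of their midpoint; in a convex set the latter is bounded below by the minimal
  norm.\<close>

lemma parallelogram_midpoint:
  fixes x y :: "'a::real_inner"
  assumes "norm x \<le> e" "norm y \<le> e" "d \<le> norm ((1/2) *\<^sub>R (x + y))" "0 \<le> d"
  shows "(norm (x - y))\<^sup>2 \<le> 4 * (e\<^sup>2 - d\<^sup>2)"
proof -
  define m where "m = (1/2) *\<^sub>R (x + y)"
  have "(norm (x - y))\<^sup>2 = 2 * (norm x)\<^sup>2 + 2 * (norm y)\<^sup>2 - 4 * (norm m)\<^sup>2"
    unfolding m_def power2_norm_eq_inner by (simp add: inner_simps inner_commute field_simps)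
  moreover have "(norm x)\<^sup>2 \<le> e\<^sup>2" "(norm y)\<^sup>2 \<le> e\<^sup>2" "d\<^sup>2 \<le> (norm m)\<^sup>2"
    using assms unfolding m_def by (intro power_mono; simp)+
  ultimately have "(norm (x - y))\<^sup>2 \<le> 2 * e\<^sup>2 + 2 * e\<^sup>2 - 4 * d\<^sup>2"
    by (simp add: add_mono diff_mono)
  then show ?thesis by simp
qed

lemma Cauchy_if_dist_sq_le:
  fixes z :: "nat \<Rightarrow> 'a::real_inner"
  assumes le: "\<And>m n. n \<le> m \<Longrightarrow> (norm (z m - z n))\<^sup>2 \<le> \<epsilon> n" and \<epsilon>: "\<epsilon> \<longlonglongrightarrow> 0"
  shows "Cauchy z"
proof (rule metric_CauchyI)
  fix e :: real assume e: "e > 0"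
  then have "\<forall>\<^sub>F n in sequentially. \<epsilon> n < (e/2)\<^sup>2"
    using order_tendstoD(2)[OF \<epsilon>] by simp
  then obtain M where M: "\<epsilon> M < (e/2)\<^sup>2" by (auto simp: eventually_sequentially)
  have half: "norm (z m - z M) < e / 2" if "M \<le> m" for m
    using power_less_imp_less_base[OF le_less_trans[OF le[OF that] M]] e by simp
  show "\<exists>M. \<forall>m\<ge>M. \<forall>n\<ge>M. dist (z m) (z n) < e"
  proof (intro exI[of _ M] allI impI)
    fix m n assume "M \<le> m" "M \<le> n"
    then show "dist (z m) (z n) < e"
      using half[of m] half[of n] dist_triangle_half_l[of "z m" "z M" e "z n"] by (simp add: dist_norm norm_minus_commute)
  qed
qed

text \<open>Closed balls need not be compact here; instead the parallelogram law makes a minimizing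
  sequence Cauchy.\<close>

lemma min_norm_element_exists:
  fixes S :: "'a::{real_inner, complete_space} set"
  assumes "closed S" "convex S" "S \<noteq> {}"
  obtains z where "z \<in> S" "\<And>y. y \<in> S \<Longrightarrow> norm z \<le> norm y"
proof -
  define d where "d = Inf (norm ` S)"
  have d: "d \<le> norm y" if "y \<in> S" for y
    unfolding d_def using that by (intro cInf_lower) (auto intro!: bdd_belowI[of _ 0])
  have d0: "0 \<le> d" unfolding d_def using assms(3) by (intro cInf_greatest) auto
  have "\<exists>y\<in>S. norm y < d + 1 / real (Suc n)" for n
    using cInf_lessD[of "norm ` S" "d + 1 / real (Suc n)"] assms(3) unfolding d_def by auto
  then obtain z where z: "\<And>n. z n \<in> S" "\<And>n. norm (z n) < d + 1 / real (Suc n)" by metis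
  define \<epsilon> where "\<epsilon> n = 4 * ((d + 1 / real (Suc n))\<^sup>2 - d\<^sup>2)" for n
  have "Cauchy z"
  proof (rule Cauchy_if_dist_sq_le)
    fix m n :: nat assume "n \<le> m"
    then have "1 / real (Suc m) \<le> 1 / real (Suc n)" by (simp add: frac_le)
    then have "norm (z m) \<le> d + 1 / real (Suc n)" using z(2)[of m] by linarith
    moreover have "(1/2) *\<^sub>R (z m + z n) \<in> S"
      using convexD[OF assms(2) z(1)[of m] z(1)[of n], of "1/2" "1/2"] by (simp add: scaleR_add_right)
    ultimately show "(norm (z m - z n))\<^sup>2 \<le> \<epsilon> n"
      unfolding \<epsilon>_def using less_imp_le[OF z(2)[of n]] d d0 by (intro parallelogram_midpoint)
  next
    have "(\<lambda>n. 4 * ((d + 1 / real (Suc n))\<^sup>2 - d\<^sup>2)) \<longlonglongrightarrow> 4 * ((d + 0)\<^sup>2 - d\<^sup>2)"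
      by (intro tendsto_intros LIMSEQ_Suc[OF lim_1_over_n])
    then show "\<epsilon> \<longlonglongrightarrow> 0" by (simp add: \<epsilon>_def[abs_def])
  qed
  then obtain l where l: "z \<longlonglongrightarrow> l" using Cauchy_convergent convergent_def by blast
  show ?thesis
  proof
    show "l \<in> S" using closed_sequentially[OF assms(1) _ l] z by blast
    fix y assume "y \<in> S"
    have "norm l \<le> d"
    proof (rule LIMSEQ_le)
      show "(\<lambda>n. norm (z n)) \<longlonglongrightarrow> norm l" by (intro tendsto_intros l)
      have "(\<lambda>n. d + 1 / real (Suc n)) \<longlonglongrightarrow> d + 0"
        by (intro tendsto_intros LIMSEQ_Suc[OF lim_1_over_n])
      then show "(\<lambda>n. d + 1 / real (Suc n)) \<longlonglongrightarrow> d" by simp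
    qed (use z(2) less_imp_le in blast)
    then show "norm l \<le> norm y" using d[OF \<open>y \<in> S\<close>] by simp
  qed
qed

text \<open>A substitute for weak compactness. The minimal-norm points of the sets have
  nondecreasing, bounded norms, so the parallelogram law makes them Cauchy, and their limit lies in
  every set.\<close>

lemma Inter_decreasing_closed_convex_nonempty:
  fixes C :: "nat \<Rightarrow> 'a::{real_inner, complete_space} set"
  assumes C: "\<And>n. closed (C n)" "\<And>n. convex (C n)" "\<And>n. C n \<noteq> {}"
    and dec: "\<And>m n. n \<le> m \<Longrightarrow> C m \<subseteq> C n" and bdd: "bounded (C 0)"
  shows "(\<Inter>n. C n) \<noteq> {}"
proof -
  have "\<exists>z. z \<in> C n \<and> (\<forall>y\<in>C n. norm z \<le> norm y)" for n
    using min_norm_element_exists[OF C(1)[of n] C(2)[of n] C(3)[of n]] by metis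
  then obtain z where z: "\<And>n. z n \<in> C n" "\<And>n y. y \<in> C n \<Longrightarrow> norm (z n) \<le> norm y" by metis
  obtain B where B: "\<And>y. y \<in> C 0 \<Longrightarrow> norm y \<le> B" using bdd by (auto simp: bounded_iff)
  have inc: "incseq (\<lambda>n. norm (z n))"
    using z dec by (intro incseq_SucI) (meson Suc_leD order_refl subset_iff)
  obtain d where d: "(\<lambda>n. norm (z n)) \<longlonglongrightarrow> d" "\<And>n. norm (z n) \<le> d"
    using incseq_convergent[OF inc, of B] B z(1) dec by (metis le0 subsetD)
  have d0: "0 \<le> d" using d(2)[of 0] norm_ge_zero order_trans by blast
  have "Cauchy z"
  proof (rule Cauchy_if_dist_sq_le)
    fix m n :: nat assume nm: "n \<le> m"
    have "z m \<in> C n" using dec[OF nm] z(1) by blast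
    then have "(1/2) *\<^sub>R (z m + z n) \<in> C n"
      using convexD[OF C(2) _ z(1)[of n], of "z m" "1/2" "1/2"] by (simp add: scaleR_add_right)
    then show "(norm (z m - z n))\<^sup>2 \<le> 4 * (d\<^sup>2 - (norm (z n))\<^sup>2)"
      using d(2) z(2) by (intro parallelogram_midpoint norm_ge_zero)
  next
    have "(\<lambda>n. 4 * (d\<^sup>2 - (norm (z n))\<^sup>2)) \<longlonglongrightarrow> 4 * (d\<^sup>2 - d\<^sup>2)"
      by (intro tendsto_intros d)
    then show "(\<lambda>n. 4 * (d\<^sup>2 - (norm (z n))\<^sup>2)) \<longlonglongrightarrow> 0" by simp
  qed
  then obtain l where l: "z \<longlonglongrightarrow> l" using Cauchy_convergent convergent_def by blast
  have "l \<in> C n" for n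
  proof (rule closed_sequentially[OF C(1)])
    show "(\<lambda>k. z (k + n)) \<longlonglongrightarrow> l" using l by (rule LIMSEQ_ignore_initial_segment)
    show "z (k + n) \<in> C n" for k using z(1)[of "k + n"] dec[of n "k + n"] by auto
  qed
  then show ?thesis by blast
qed

text \<open>The point \<open>z\<close> of least norm on the hyperplane \<open>f = 1\<close> is
  orthogonal to the kernel of \<open>f\<close>, and \<open>h - f h *\<^sub>R z\<close> lies in that
  kernel.\<close>

lemma riesz_representation:
  fixes f :: "'a::{real_inner, complete_space} \<Rightarrow> real"
  assumes "bounded_linear f"
  shows "\<exists>D. f = (\<lambda>h. inner h D)"
proof (cases "\<forall>x. f x = 0")
  case True
  then show ?thesis by (intro exI[of _ 0]) auto
next
  case False
  interpret f: bounded_linear f by fact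
  define S where "S = f -` {1}"
  obtain x0 where x0: "f x0 \<noteq> 0" using False by blast
  have "closed S" unfolding S_def
    by (intro closed_vimage) (auto intro: linear_continuous_on assms)
  moreover have "convex S"
    by (auto simp: S_def convex_def f.add f.scaleR)
  moreover have "(1 / f x0) *\<^sub>R x0 \<in> S" using x0 by (simp add: S_def f.scaleR)
  ultimately obtain z where z: "z \<in> S" "\<And>y. y \<in> S \<Longrightarrow> norm z \<le> norm y"
    by (metis min_norm_element_exists empty_iff)
  have fz: "f z = 1" using z by (simp add: S_def)
  then have zz: "inner z z > 0" by (metis f.zero inner_gt_zero_iff zero_neq_one)
  have orth: "inner k z = 0" if "f k = 0" for k
  proof (cases "k = 0")
    case False
    have kk: "inner k k > 0" using False by simp
    \<comment> \<open>This \<open>r\<close> minimizes the norm of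
      \<open>z + r *\<^sub>R k\<close>.\<close>
    define r where "r = - inner k z / inner k k"
    have "norm z \<le> norm (z + r *\<^sub>R k)"
      using that fz by (intro z) (simp add: S_def f.add f.scaleR)
    then have "inner z z \<le> inner (z + r *\<^sub>R k) (z + r *\<^sub>R k)"
      using norm_le by blast
    also have "\<dots> = inner z z + 2 * r * inner k z + r * (r * inner k k)"
      by (simp add: inner_simps inner_commute algebra_simps)
    also have "r * inner k k = - inner k z" using kk by (simp add: r_def)
    finally have "0 \<le> r * inner k z" by (simp add: algebra_simps)
    then have "(inner k z)\<^sup>2 / inner k k \<le> 0" by (simp add: r_def power2_eq_square)
    then show ?thesis using kk by (simp add: divide_le_0_iff)
  qed simp
  show ?thesis
  proof (intro exI ext)
    fix h
    have "inner (h - f h *\<^sub>R z) z = 0" by (rule orth) (simp add: f.diff f.scaleR fz)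
    then have "inner h z = f h * inner z z" by (simp add: inner_diff_left)
    then show "f h = inner h ((1 / inner z z) *\<^sub>R z)" using zz by simp
  qed
qed

text \<open>For each \<open>e\<close> the points where \<open>f\<close> is within \<open>e\<close>
  of \<open>l\<close> form a closed convex set that contains a tail of the sequence, hence its
  closed convex hull. Common points of the hulls thus play the part of weak cluster points.\<close>

lemma closure_hull_tail_limit:
  fixes f :: "'a::real_normed_vector \<Rightarrow> real"
  assumes f: "bounded_linear f" and z: "\<And>n. z \<in> closure (convex hull (s ` {n..}))"
    and lim: "(\<lambda>n. f (s n)) \<longlonglongrightarrow> l"
  shows "f z = l"
proof -
  interpret f: bounded_linear f by fact
  have "\<bar>f z - l\<bar> \<le> e" if e: "e > 0" for e :: real
  proof -
    obtain N where N: "\<And>n. n \<ge> N \<Longrightarrow> \<bar>f (s n) - l\<bar> < e"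
      using LIMSEQ_D[OF lim e] by auto
    have "closed (f -` {l - e..l + e})"
      by (intro closed_vimage) (auto intro: linear_continuous_on f)
    moreover have "convex (f -` {l - e..l + e})"
      by (intro convex_linear_vimage f.linear_axioms) auto
    moreover have "s ` {N..} \<subseteq> f -` {l - e..l + e}"
      using N by (force simp: abs_less_iff)
    ultimately have "closure (convex hull (s ` {N..})) \<subseteq> f -` {l - e..l + e}"
      by (intro closure_minimal hull_minimal) auto
    then show ?thesis using z[of N] by (auto simp: abs_le_iff)
  qed
  then show ?thesis
    by (metis abs_le_zero_iff dense_ge eq_iff_diff_eq_0)
qed

lemma closure_hull_tail_exists:
  fixes s :: "nat \<Rightarrow> 'a::{real_inner, complete_space}"
  assumes "bounded (range s)"
  obtains z where "\<And>n. z \<in> closure (convex hull (s ` {n..}))"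
proof -
  have "(\<Inter>n. closure (convex hull (s ` {n..}))) \<noteq> {}"
  proof (rule Inter_decreasing_closed_convex_nonempty)
    fix n m :: nat assume "n \<le> m"
    then show "closure (convex hull (s ` {m..})) \<subseteq> closure (convex hull (s ` {n..}))"
      by (intro closure_mono hull_mono image_mono) auto
  qed (use assms in \<open>auto simp: bounded_convex_hull bounded_closure atLeast_0 intro: convex_closure\<close>)
  then show ?thesis using that by blast
qed

text \<open>Opial's lemma, with sequential weak cluster points replaced by common points of the closed
  convex hulls of the tails.\<close>

lemma opial_weakly_tendsto:
  fixes x :: "real \<Rightarrow> 'a::{real_inner, complete_space}"
  assumes ne: "S \<noteq> {}"
    and dist: "\<And>z. z \<in> S \<Longrightarrow> \<exists>l. ((\<lambda>t. (norm (x t - z))\<^sup>2) \<longlongrightarrow> l) at_top"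
    and cluster: "\<And>s z. filterlim s at_top sequentially \<Longrightarrow>
       (\<And>n. z \<in> closure (convex hull ((\<lambda>k. x (s k)) ` {n..}))) \<Longrightarrow> z \<in> S"
  shows "\<exists>z\<in>S. weakly_tendsto x z at_top"
proof -
  obtain z0 where z0: "z0 \<in> S" using ne by blast
  obtain l0 where l0: "((\<lambda>t. (norm (x t - z0))\<^sup>2) \<longlongrightarrow> l0) at_top" using dist[OF z0] by blast
  have "\<forall>\<^sub>F t in at_top. (norm (x t - z0))\<^sup>2 < l0 + 1"
    using order_tendstoD(2)[OF l0] by simp
  then obtain T where T: "\<And>t. t \<ge> T \<Longrightarrow> (norm (x t - z0))\<^sup>2 < l0 + 1"
    by (auto simp: eventually_at_top_linorder)
  define B where "B = norm z0 + sqrt (l0 + 1)"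
  have B: "norm (x t) \<le> B" if "t \<ge> T" for t
    using real_le_rsqrt[of "norm (x t - z0)" "l0 + 1"] T[OF that] norm_triangle_sub[of "x t" z0]
    unfolding B_def by linarith
  \<comment> \<open>Polarization: the difference of two squared distances is affine in
    \<open>x t\<close>, with linear part a multiple of \<open>inner (x t) (z - z')\<close>.\<close>
  have inner_lim: "\<exists>l. ((\<lambda>t. inner (x t) (z - z')) \<longlongrightarrow> l) at_top" if zS: "z \<in> S" "z' \<in> S" for z z'
  proof -
    obtain l l' where "((\<lambda>t. (norm (x t - z))\<^sup>2) \<longlongrightarrow> l) at_top" "((\<lambda>t. (norm (x t - z'))\<^sup>2) \<longlongrightarrow> l') at_top"
      using dist zS by metis
    then have "((\<lambda>t. ((norm (x t - z'))\<^sup>2 - (norm (x t - z))\<^sup>2 + (inner z z - inner z' z')) / 2)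
        \<longlongrightarrow> (l' - l + (inner z z - inner z' z')) / 2) at_top"
      by (intro tendsto_intros) auto
    moreover have "((norm (x t - z'))\<^sup>2 - (norm (x t - z))\<^sup>2 + (inner z z - inner z' z')) / 2 = inner (x t) (z - z')" for t
      unfolding power2_norm_eq_inner by (simp add: inner_simps inner_commute)
    ultimately show ?thesis by auto
  qed
  have tail: "\<exists>z. \<forall>n. z \<in> closure (convex hull ((\<lambda>k. x (s k)) ` {n..}))" if s: "\<And>k. s k \<ge> T" for s :: "nat \<Rightarrow> real"
  proof -
    have "bounded (range (\<lambda>k. x (s k)))" using B s by (auto simp: bounded_iff)
    from closure_hull_tail_exists[OF this] show ?thesis by metis
  qed
  define s0 where "s0 k = T + real k" for k
  have s0: "filterlim s0 at_top sequentially" unfolding s0_def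
    by (intro filterlim_tendsto_add_at_top[OF tendsto_const] filterlim_real_sequentially)
  obtain z where z: "\<And>n. z \<in> closure (convex hull ((\<lambda>k. x (s0 k)) ` {n..}))"
    using tail[of s0] by (auto simp: s0_def)
  have zS: "z \<in> S" using cluster[OF s0 z] .
  have "weakly_tendsto x z at_top"
    unfolding weakly_tendsto_def
  proof (intro allI impI)
    fix f :: "'a \<Rightarrow> real" assume f: "bounded_linear f"
    interpret f: bounded_linear f by fact
    show "((\<lambda>t. f (x t)) \<longlongrightarrow> f z) at_top"
    proof (rule ccontr)
      assume "\<not> ((\<lambda>t. f (x t)) \<longlongrightarrow> f z) at_top"
      then obtain e where e: "e > 0" "\<not> (\<forall>\<^sub>F t in at_top. dist (f (x t)) (f z) < e)"
        by (auto simp: tendsto_iff)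
      \<comment> \<open>Times beyond \<open>T\<close> keep the trajectory bounded, times beyond
        \<open>n\<close> go to infinity.\<close>
      then have "\<exists>t\<ge>max T (real n). dist (f (x t)) (f z) \<ge> e" for n
        unfolding eventually_at_top_linorder not_ex not_all not_imp not_less by blast
      then obtain s where s: "\<And>n. s n \<ge> max T (real n)" "\<And>n. dist (f (x (s n))) (f z) \<ge> e" by metis
      obtain K where K: "\<And>y. norm (f y) \<le> norm y * K" "K > 0" using f.pos_bounded by blast
      have "norm (f (x (s n))) \<le> B * K" for n
        using order_trans[OF K(1) mult_right_mono[OF B]] s(1) K(2) by simp
      then have "bounded (range (\<lambda>n. f (x (s n))))"
        unfolding bounded_iff by blast
      from bounded_imp_convergent_subsequence[OF this]
      obtain l r where lr: "strict_mono r" "((\<lambda>n. f (x (s n))) \<circ> r) \<longlonglongrightarrow> l" by blast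
      have sT: "filterlim s at_top sequentially"
        by (rule filterlim_at_top_mono[OF filterlim_real_sequentially]) (use s(1) in auto)
      have sr: "filterlim (s \<circ> r) at_top sequentially"
        using filterlim_compose[OF sT filterlim_subseq[OF lr(1)]] by (simp add: comp_def)
      obtain z' where z': "\<And>n. z' \<in> closure (convex hull ((\<lambda>k. x ((s \<circ> r) k)) ` {n..}))"
        using tail[of "s \<circ> r"] s(1) by auto
      have z'S: "z' \<in> S" using cluster[OF sr z'] .
      have fz': "f z' = l" by (rule closure_hull_tail_limit[OF f z']) (use lr in \<open>simp add: comp_def\<close>)
      \<comment> \<open>\<open>z\<close> and \<open>z'\<close> have the same inner product with
        \<open>z - z'\<close>, so they coincide; then \<open>f\<close> converges to
        \<open>f z\<close> along the subsequence, against the choice of \<open>s\<close>.\<close>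
      obtain m where m: "((\<lambda>t. inner (x t) (z - z')) \<longlongrightarrow> m) at_top" using inner_lim[OF zS z'S] by blast
      have bl: "bounded_linear (\<lambda>y. inner y (z - z'))" by (rule bounded_linear_inner_left)
      have "inner z (z - z') = m"
        by (rule closure_hull_tail_limit[OF bl z filterlim_compose[OF m s0]])
      moreover have "inner z' (z - z') = m"
        by (rule closure_hull_tail_limit[OF bl z' filterlim_compose[OF m sr]])
      ultimately have "inner (z - z') (z - z') = 0" by (simp add: inner_diff_left)
      then have "f z = l" using fz' by simp
      then have "((\<lambda>n. dist (f (x (s (r n)))) (f z)) \<longlonglongrightarrow> 0)"
        using lr(2) tendsto_dist[OF lr(2) tendsto_const[of "f z"]] by (simp add: comp_def)
      then have "e \<le> 0" by (rule LIMSEQ_le_const) (use s(2) in auto)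
      then show False using e by simp
    qed
  qed
  then show ?thesis using zS by blast
qed

section \<open>Regularity of solutions\<close>

lemma abs_continuous_on_subinterval:
  assumes "abs_continuous_on a b f" "a \<le> c" "d \<le> b"
  shows "abs_continuous_on c d f"
  unfolding abs_continuous_on_def
proof (intro allI impI)
  fix \<epsilon> :: real assume "\<epsilon> > 0"
  from assms(1)[unfolded abs_continuous_on_def, THEN spec, THEN mp, OF this]
  obtain \<eta> where "\<eta> > 0" and \<eta>: "\<forall>D. finite D \<and> (\<forall>(u, v)\<in>D. a \<le> u \<and> u \<le> v \<and> v \<le> b) \<and>
        disjoint_family_on (\<lambda>(u, v). {u<..<v}) D \<and> (\<Sum>(u, v)\<in>D. v - u) < \<eta>
        \<longrightarrow> (\<Sum>(u, v)\<in>D. norm (f v - f u)) < \<epsilon>" by (elim exE conjE)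
  show "\<exists>\<eta>>0. \<forall>D. finite D \<and> (\<forall>(u, v)\<in>D. c \<le> u \<and> u \<le> v \<and> v \<le> d) \<and>
        disjoint_family_on (\<lambda>(u, v). {u<..<v}) D \<and> (\<Sum>(u, v)\<in>D. v - u) < \<eta>
        \<longrightarrow> (\<Sum>(u, v)\<in>D. norm (f v - f u)) < \<epsilon>"
  proof (intro exI[of _ \<eta>] conjI allI impI \<open>\<eta> > 0\<close>, elim conjE)
    fix D :: "(real \<times> real) set"
    assume D: "finite D" "\<forall>(u, v)\<in>D. c \<le> u \<and> u \<le> v \<and> v \<le> d"
      "disjoint_family_on (\<lambda>(u, v). {u<..<v}) D" "(\<Sum>(u, v)\<in>D. v - u) < \<eta>"
    show "(\<Sum>(u, v)\<in>D. norm (f v - f u)) < \<epsilon>"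
      by (intro \<eta>[THEN spec, THEN mp] conjI D) (use D(2) assms(2,3) in fastforce)
  qed
qed

text \<open>Pairing with a fixed vector reduces the integrals below to scalar ones.\<close>

lemma abs_continuous_on_inner:
  fixes f :: "real \<Rightarrow> 'a::real_inner"
  assumes "abs_continuous_on a b f"
  shows "abs_continuous_on a b (\<lambda>t. inner (f t) z)"
  unfolding abs_continuous_on_def
proof (intro allI impI)
  fix \<epsilon> :: real assume e: "\<epsilon> > 0"
  have nz: "norm z + 1 > 0" by (simp add: add_nonneg_pos)
  have "\<epsilon> / (norm z + 1) > 0" using e nz by simp
  from assms(1)[unfolded abs_continuous_on_def, THEN spec, THEN mp, OF this]
  obtain \<eta> where "\<eta> > 0" and \<eta>: "\<forall>D. finite D \<and> (\<forall>(u, v)\<in>D. a \<le> u \<and> u \<le> v \<and> v \<le> b) \<and>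
        disjoint_family_on (\<lambda>(u, v). {u<..<v}) D \<and> (\<Sum>(u, v)\<in>D. v - u) < \<eta>
        \<longrightarrow> (\<Sum>(u, v)\<in>D. norm (f v - f u)) < \<epsilon> / (norm z + 1)" by (elim exE conjE)
  show "\<exists>\<eta>>0. \<forall>D. finite D \<and> (\<forall>(u, v)\<in>D. a \<le> u \<and> u \<le> v \<and> v \<le> b) \<and>
        disjoint_family_on (\<lambda>(u, v). {u<..<v}) D \<and> (\<Sum>(u, v)\<in>D. v - u) < \<eta>
        \<longrightarrow> (\<Sum>(u, v)\<in>D. norm (inner (f v) z - inner (f u) z)) < \<epsilon>"
  proof (intro exI[of _ \<eta>] conjI allI impI \<open>\<eta> > 0\<close>)
    fix D :: "(real \<times> real) set"
    assume D: "finite D \<and> (\<forall>(u, v)\<in>D. a \<le> u \<and> u \<le> v \<and> v \<le> b) \<and>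
        disjoint_family_on (\<lambda>(u, v). {u<..<v}) D \<and> (\<Sum>(u, v)\<in>D. v - u) < \<eta>"
    have "norm (inner (f v) z - inner (f u) z) \<le> norm (f v - f u) * (norm z + 1)" for u v
    proof -
      have "norm (inner (f v) z - inner (f u) z) \<le> norm (f v - f u) * norm z"
        using Cauchy_Schwarz_ineq2[of "f v - f u" z] by (simp add: inner_diff_left)
      also have "\<dots> \<le> norm (f v - f u) * (norm z + 1)" by (intro mult_left_mono) auto
      finally show ?thesis .
    qed
    then have "(\<Sum>(u, v)\<in>D. norm (inner (f v) z - inner (f u) z))
        \<le> (\<Sum>(u, v)\<in>D. norm (f v - f u) * (norm z + 1))"
      by (intro sum_mono) auto
    also have "\<dots> = (\<Sum>(u, v)\<in>D. norm (f v - f u)) * (norm z + 1)"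
      by (simp add: sum_distrib_right case_prod_unfold)
    also have "\<dots> < \<epsilon>"
      using \<eta>[THEN spec, THEN mp, OF D] nz by (simp add: pos_less_divide_eq)
    finally show "(\<Sum>(u, v)\<in>D. norm (inner (f v) z - inner (f u) z)) < \<epsilon>" .
  qed
qed

lemma abs_continuous_on_imp_norm_diff_less:
  assumes "abs_continuous_on a b f" "\<epsilon> > 0"
  obtains \<eta> where "\<eta> > 0" "\<And>u v. a \<le> u \<Longrightarrow> u \<le> v \<Longrightarrow> v \<le> b \<Longrightarrow> v - u < \<eta> \<Longrightarrow> norm (f v - f u) < \<epsilon>"
proof -
  from assms(1)[unfolded abs_continuous_on_def, THEN spec, THEN mp, OF assms(2)]
  obtain \<eta> where "\<eta> > 0" and \<eta>: "\<forall>D. finite D \<and> (\<forall>(u, v)\<in>D. a \<le> u \<and> u \<le> v \<and> v \<le> b) \<and>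
        disjoint_family_on (\<lambda>(u, v). {u<..<v}) D \<and> (\<Sum>(u, v)\<in>D. v - u) < \<eta>
        \<longrightarrow> (\<Sum>(u, v)\<in>D. norm (f v - f u)) < \<epsilon>" by (elim exE conjE)
  show ?thesis
  proof
    fix u v assume "a \<le> u" "u \<le> v" "v \<le> b" "v - u < \<eta>"
    then show "norm (f v - f u) < \<epsilon>"
      using \<eta>[THEN spec, of "{(u, v)}"] by (simp add: disjoint_family_on_def)
  qed fact
qed

lemma locally_abs_continuous_from_imp_continuous_on:
  assumes "locally_abs_continuous_from t0 f"
  shows "continuous_on {t0..} f"
  unfolding continuous_on_iff
proof (intro ballI allI impI)
  fix t e :: real assume t: "t \<in> {t0..}" and e: "e > 0"
  have "abs_continuous_on t0 (t + 1) f" using assms t by (auto simp: locally_abs_continuous_from_def)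
  from abs_continuous_on_imp_norm_diff_less[OF this e] obtain \<eta> where \<eta>: "\<eta> > 0"
    "\<And>u v. t0 \<le> u \<Longrightarrow> u \<le> v \<Longrightarrow> v \<le> t + 1 \<Longrightarrow> v - u < \<eta> \<Longrightarrow> norm (f v - f u) < e" by blast
  show "\<exists>d>0. \<forall>s\<in>{t0..}. dist s t < d \<longrightarrow> dist (f s) (f t) < e"
  \<comment> \<open>The bound 1 keeps \<open>s\<close> below \<open>t + 1\<close>, the end of the
    interval on which absolute continuity is used.\<close>
  proof (intro exI[of _ "min \<eta> 1"] conjI ballI impI)
    fix s assume s: "s \<in> {t0..}" "dist s t < min \<eta> 1"
    show "dist (f s) (f t) < e"
    proof (cases "s \<le> t")
      case True
      then have "norm (f t - f s) < e" using s t by (intro \<eta>(2)) (auto simp: dist_real_def)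
      then show ?thesis by (simp add: dist_norm norm_minus_commute)
    next
      case False
      then have "norm (f s - f t) < e" using s t by (intro \<eta>(2)) (auto simp: dist_real_def)
      then show ?thesis by (simp add: dist_norm)
    qed
  qed (use \<eta> in auto)
qed

text \<open>The derivative of \<open>y\<close> exists only almost everywhere and that of \<open>d\<close> need not be locally
  bounded, but the a.e. derivative of their sum is continuous, and so the sum is in fact
  continuously differentiable.\<close>

lemma abs_continuous_plus_differentiable_has_vector_derivative:
  fixes y d r :: "real \<Rightarrow> 'a::real_inner"
  assumes ac: "locally_abs_continuous_from t0 y"
    and d: "\<And>t. t \<ge> t0 \<Longrightarrow> (d has_vector_derivative d' t) (at t within {t0..})"
    and r: "continuous_on {t0..} r"
    and N: "negligible N"
    and y: "\<And>t. t \<ge> t0 \<Longrightarrow> t \<notin> N \<Longrightarrow> (y has_vector_derivative (r t - d' t)) (at t within {t0..})"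
    and t: "t \<ge> t0"
  shows "((\<lambda>t. y t + d t) has_vector_derivative r t) (at t within {t0..})"
proof -
  define w where "w t = y t + d t" for t
  \<comment> \<open>The derivative of \<open>y\<close> is integrable by absolute continuity, that of
    \<open>d\<close> because it exists everywhere; the terms with \<open>d'\<close> cancel in the
    sum.\<close>
  have int: "((\<lambda>s. inner (r s) z) has_integral inner (w b - w a) z) {a..b}" if ab: "t0 \<le> a" "a \<le> b" for a b z
  proof -
    have sub: "{a..b} \<subseteq> {t0..}" using ab by auto
    have inner: "((\<lambda>t. inner (f t) z) has_vector_derivative inner f' z) (at s within {a..b})"
      if "(f has_vector_derivative f') (at s within {t0..})" for f :: "real \<Rightarrow> 'a" and f' s
      by (rule bounded_linear.has_vector_derivative[OF bounded_linear_inner_left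
          has_vector_derivative_within_subset[OF that sub]])
    have "abs_continuous_on t0 b y"
      using ac ab by (simp add: locally_abs_continuous_from_def)
    then have acz: "abs_continuous_on a b (\<lambda>t. inner (y t) z)"
      by (intro abs_continuous_on_inner) (rule abs_continuous_on_subinterval[OF _ ab(1) order_refl])
    have 1: "((\<lambda>s. inner (r s - d' s) z) has_integral inner (y b) z - inner (y a) z) {a..b}"
    proof (rule has_integral_derivative_abs_continuous[OF acz ab(2) N])
      fix s assume "s \<in> {a..b} - N"
      then show "((\<lambda>t. inner (y t) z) has_vector_derivative inner (r s - d' s) z) (at s within {a..b})"
        using ab by (intro inner y) auto
    qed
    have 2: "((\<lambda>s. inner (d' s) z) has_integral inner (d b) z - inner (d a) z) {a..b}"
    proof (rule fundamental_theorem_of_calculus[OF ab(2)])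
      fix s assume "s \<in> {a..b}"
      then show "((\<lambda>t. inner (d t) z) has_vector_derivative inner (d' s) z) (at s within {a..b})"
        using ab by (intro inner d) auto
    qed
    show ?thesis using has_integral_add[OF 1 2] by (simp add: w_def inner_simps algebra_simps)
  qed
  have bound: "norm (w b - w a - (b - a) *\<^sub>R c) \<le> e * (b - a)"
    if ab: "t0 \<le> a" "a \<le> b" and e: "e \<ge> 0" "\<And>s. s \<in> {a..b} \<Longrightarrow> norm (r s - c) \<le> e" for a b c e
  proof -
    \<comment> \<open>Pairing the error vector with itself turns the scalar integral identity into a
      norm estimate.\<close>
    define z where "z = w b - w a - (b - a) *\<^sub>R c"
    have "((\<lambda>s. inner (r s) z - inner c z) has_integral inner (w b - w a) z - (b - a) * inner c z) {a..b}"
      using has_integral_diff[OF int[OF ab, of z] has_integral_const_real[of "inner c z" a b]] ab by simp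
    then have i: "((\<lambda>s. inner (r s) z - inner c z) has_integral inner z z) {a..b}"
      by (simp add: z_def inner_diff_left)
    have "norm (inner (r s) z - inner c z) \<le> e * norm z" if "s \<in> {a..b}" for s
      using Cauchy_Schwarz_ineq2[of "r s - c" z] e(2)[OF that]
      by (simp add: inner_diff_left[symmetric]) (meson mult_right_mono norm_ge_zero order_trans)
    then have "norm (inner z z) \<le> e * norm z * measure lborel {a..b}"
      using e by (intro has_integral_bound_real[OF _ finite.emptyI i]) auto
    then have "norm z * norm z \<le> (e * (b - a)) * norm z"
      using ab by (simp add: power2_norm_eq_inner[symmetric] power2_eq_square mult_ac)
    then show ?thesis
      unfolding z_def[symmetric] using e ab by (cases "norm z = 0") (auto simp: mult_le_cancel_right)
  qed
  have "(w has_vector_derivative r t) (at t within {t0..})"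
    unfolding has_vector_derivative_def has_derivative_within_alt
  proof (intro conjI allI impI)
    fix e :: real assume e: "e > 0"
    then obtain \<eta> where \<eta>: "\<eta> > 0" "\<And>s. s \<ge> t0 \<Longrightarrow> dist s t < \<eta> \<Longrightarrow> dist (r s) (r t) < e"
      using r t unfolding continuous_on_iff by (meson atLeast_iff)
    show "\<exists>\<eta>>0. \<forall>s\<in>{t0..}. norm (s - t) < \<eta> \<longrightarrow> norm (w s - w t - (s - t) *\<^sub>R r t) \<le> e * norm (s - t)"
    proof (intro exI[of _ \<eta>] conjI ballI impI \<eta>(1))
      fix s assume s: "s \<in> {t0..}" "norm (s - t) < \<eta>"
      have close: "norm (r \<tau> - r t) \<le> e" if "\<tau> \<ge> t0" "\<bar>\<tau> - t\<bar> < \<eta>" for \<tau>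
        using \<eta>(2)[of \<tau>] that by (auto simp: dist_norm)
      show "norm (w s - w t - (s - t) *\<^sub>R r t) \<le> e * norm (s - t)"
      proof (cases "s \<le> t")
        case True
        have "norm (w t - w s - (t - s) *\<^sub>R r t) \<le> e * (t - s)"
          using s True e by (intro bound close) auto
        moreover have "w s - w t - (s - t) *\<^sub>R r t = - (w t - w s - (t - s) *\<^sub>R r t)"
          by (simp add: algebra_simps)
        ultimately show ?thesis using True by (metis norm_minus_cancel real_norm_def abs_of_nonpos diff_le_0_iff_le minus_diff_eq)
      next
        case False
        then have "norm (w s - w t - (s - t) *\<^sub>R r t) \<le> e * (s - t)"
          using s t e by (intro bound close) auto
        then show ?thesis using False by simp
      qed
    qed
  qed (rule bounded_linear_scaleR_left)
  then show ?thesis by (simp add: w_def[abs_def])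
qed

section \<open>Gradients and convexity\<close>

lemma twice_differentiable_grad:
  fixes g :: "'a::{real_inner, complete_space} \<Rightarrow> real"
  assumes "twice_differentiable g"
  shows "(g has_derivative (\<lambda>h. inner h (grad g x))) (at x)"
    and "(grad g has_derivative hessian g x) (at x)"
proof -
  obtain f where f: "(g has_derivative f) (at x)"
    using assms by (auto simp: twice_differentiable_def differentiable_def)
  obtain D where D: "f = (\<lambda>h. inner h D)"
    using riesz_representation[OF has_derivative_bounded_linear[OF f]] by blast
  have GD: "GDERIV g x :> D" using f D by (simp add: gderiv_def)
  \<comment> \<open>Derivatives are unique and a vector is determined by its inner products, so the
    description in \<open>grad\<close> denotes \<open>D\<close>.\<close>
  have "grad g x = D"
    unfolding grad_def
  proof (rule the_equality)
    fix D' assume "GDERIV g x :> D'"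
    then have "(\<lambda>h. inner h D') = (\<lambda>h. inner h D)"
      using GD has_derivative_unique unfolding gderiv_def by blast
    then show "D' = D" by (metis inner_commute vector_eq_ldot)
  qed fact
  then show "(g has_derivative (\<lambda>h. inner h (grad g x))) (at x)" using f D by simp
  show "(grad g has_derivative hessian g x) (at x)"
    unfolding hessian_def using assms by (simp add: twice_differentiable_def frechet_derivative_works)
qed

text \<open>On the line through \<open>x\<close> and \<open>y\<close> this is the tangent inequality
  for a convex function of one variable.\<close>

lemma convex_above_gradient:
  fixes g :: "'a::real_inner \<Rightarrow> real"
  assumes "convex_on UNIV g" and D: "(g has_derivative (\<lambda>h. inner h D)) (at x)"
  shows "g x - g y \<le> inner D (x - y)"
proof -
  define \<phi> where "\<phi> s = g (x + s *\<^sub>R (y - x))" for s :: real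
  have "convex_on UNIV \<phi>"
  proof (rule convex_onI)
    fix t s s' :: real assume t: "0 < t" "t < 1"
    have "x + ((1 - t) *\<^sub>R s + t *\<^sub>R s') *\<^sub>R (y - x)
        = (1 - t) *\<^sub>R (x + s *\<^sub>R (y - x)) + t *\<^sub>R (x + s' *\<^sub>R (y - x))"
      by (simp add: algebra_simps)
    then show "\<phi> ((1 - t) *\<^sub>R s + t *\<^sub>R s') \<le> (1 - t) * \<phi> s + t * \<phi> s'"
      unfolding \<phi>_def using convex_onD[OF assms(1), of t "x + s *\<^sub>R (y - x)" "x + s' *\<^sub>R (y - x)"] t by simp
  qed simp
  moreover have "(\<phi> has_real_derivative inner (y - x) D) (at 0)"
  proof -
    have "((\<lambda>s. x + s *\<^sub>R (y - x)) has_derivative (\<lambda>s. s *\<^sub>R (y - x))) (at (0::real))"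
      by (auto intro!: derivative_eq_intros)
    from has_derivative_compose[OF this, of g "\<lambda>h. inner h D"] D
    show ?thesis by (simp add: \<phi>_def[abs_def] has_field_derivative_def mult.commute[of _ "inner _ _"])
  qed
  ultimately have "\<phi> 1 - \<phi> 0 \<ge> inner (y - x) D * (1 - 0)"
    by (intro convex_on_imp_above_tangent[of UNIV]) auto
  then show ?thesis by (simp add: \<phi>_def inner_diff_left inner_diff_right inner_commute)
qed

section \<open>Lyapunov analysis\<close>

lemma nonincreasing_bounded_below_tendsto:
  fixes f :: "real \<Rightarrow> real"
  assumes mono: "\<And>s t. T \<le> s \<Longrightarrow> s \<le> t \<Longrightarrow> f t \<le> f s" and bdd: "\<And>t. t \<ge> T \<Longrightarrow> B \<le> f t"
  shows "\<exists>l. (f \<longlongrightarrow> l) at_top"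
proof
  define l where "l = Inf (f ` {T..})"
  have bb: "bdd_below (f ` {T..})" using bdd by (auto intro!: bdd_belowI2)
  show "(f \<longlongrightarrow> l) at_top"
  proof (rule decreasing_tendsto)
    show "\<forall>\<^sub>F t in at_top. l \<le> f t"
      using eventually_ge_at_top[of T] by eventually_elim (auto simp: l_def intro!: cInf_lower bb)
  next
    fix c assume "l < c"
    then obtain s where s: "s \<ge> T" "f s < c"
      using cInf_lessD[of "f ` {T..}" c] by (auto simp: l_def)
    show "\<forall>\<^sub>F t in at_top. f t < c"
      using eventually_ge_at_top[of s] by eventually_elim (use mono s le_less_trans in blast)
  qed
qed

lemma tendsto_powr_minus_at_top:
  assumes "c < 0"
  shows "((\<lambda>t::real. t powr c) \<longlongrightarrow> 0) at_top"
  using assms by (intro tendsto_neg_powr filterlim_ident)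

lemma powr_pos_at_top:
  assumes "c > 0"
  shows "filterlim (\<lambda>t::real. t powr c) at_top at_top"
proof -
  have "filterlim (\<lambda>t::real. exp (c * ln t)) at_top at_top"
    using assms by (intro filterlim_compose[OF exp_at_top]
      filterlim_tendsto_pos_mult_at_top[OF tendsto_const] ln_at_top)
  then show ?thesis
    by (rule filterlim_mono_eventually[OF _ order_refl order_refl])
      (use eventually_gt_at_top[of 0] in \<open>eventually_elim, simp add: powr_def\<close>)
qed

text \<open>The multiple of \<open>t powr (1 - m)\<close> added to \<open>f\<close> has derivative
  \<open>- C * t powr (- m)\<close>, so the sum is nonincreasing and bounded below; as
  \<open>m > 1\<close>, the correction vanishes at infinity.\<close>

lemma tendsto_of_deriv_le_integrable:
  fixes f :: "real \<Rightarrow> real"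
  assumes T: "T > 0" and m: "m > 1" and C: "C \<ge> 0"
    and deriv: "\<And>t. t \<ge> T \<Longrightarrow> (f has_real_derivative f' t) (at t)"
    and le: "\<And>t. t \<ge> T \<Longrightarrow> f' t \<le> C * t powr (-m)"
    and bdd: "\<And>t. t \<ge> T \<Longrightarrow> B \<le> f t"
  shows "\<exists>l. (f \<longlongrightarrow> l) at_top"
proof -
  define \<phi> where "\<phi> t = f t + C / (m - 1) * t powr (1 - m)" for t
  have "\<phi> t \<le> \<phi> s" if st: "T \<le> s" "s \<le> t" for s t
  proof (rule DERIV_nonpos_imp_nonincreasing[OF st(2)])
    fix v assume v: "s \<le> v" "v \<le> t"
    have "(\<phi> has_real_derivative f' v + C / (m - 1) * ((1 - m) * v powr (1 - m - 1))) (at v)"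
      unfolding \<phi>_def using v st T m
      by (intro DERIV_add DERIV_cmult has_real_derivative_powr deriv) auto
    moreover have "C / (m - 1) * ((1 - m) * v powr (1 - m - 1)) = - (C * v powr (- m))"
      using m by (simp add: field_simps)
    ultimately show "\<exists>y. (\<phi> has_real_derivative y) (at v) \<and> y \<le> 0"
      using le[of v] v st by (intro exI[of _ "f' v - C * v powr (- m)"]) auto
  qed
  moreover have "B \<le> \<phi> t" if "t \<ge> T" for t
    using bdd[OF that] C m unfolding \<phi>_def by (simp add: add_increasing2)
  ultimately obtain l where l: "(\<phi> \<longlongrightarrow> l) at_top"
    using nonincreasing_bounded_below_tendsto[of T \<phi> B] by blast
  have "((\<lambda>t. \<phi> t - C / (m - 1) * t powr (1 - m)) \<longlongrightarrow> l - C / (m - 1) * 0) at_top"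
    using m by (intro tendsto_intros l tendsto_powr_minus_at_top) auto
  then show ?thesis by (auto simp: \<phi>_def)
qed

text \<open>Since \<open>t powr (-q)\<close> is not integrable, dissipation at that rate forces the limit to vanish.\<close>

lemma limit_nonpos_of_dissipation:
  fixes f Q :: "real \<Rightarrow> real"
  assumes T: "T > 0" and m: "m > 1" and C: "C \<ge> 0" and q: "q < 1" and \<kappa>: "\<kappa> > 0"
    and deriv: "\<And>t. t \<ge> T \<Longrightarrow> (f has_real_derivative f' t) (at t)"
    and le: "\<And>t. t \<ge> T \<Longrightarrow> f' t \<le> C * t powr (-m) - \<kappa> * t powr (-q) * Q t"
    and bdd: "\<And>t. t \<ge> T \<Longrightarrow> B \<le> f t"
    and Q: "(Q \<longlongrightarrow> l) at_top"
  shows "l \<le> 0"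
proof (rule ccontr)
  assume "\<not> l \<le> 0"
  then have l: "l > 0" by simp
  then have "\<forall>\<^sub>F t in at_top. Q t > l / 2"
    by (intro order_tendstoD[OF Q]) auto
  then obtain T1 where T1: "\<And>t. t \<ge> T1 \<Longrightarrow> Q t > l / 2"
    by (auto simp: eventually_at_top_linorder)
  define T' where "T' = max T T1"
  define k where "k = \<kappa> * (l / 2)"
  have k: "k > 0" using \<kappa> l by (simp add: k_def)
  \<comment> \<open>If \<open>l > 0\<close>, adding an antiderivative of
    \<open>k * t powr (- q)\<close> still leaves a nonincreasing function, which would bound
    \<open>t powr (1 - q)\<close>.\<close>
  define \<phi> where "\<phi> t = f t + C / (m - 1) * t powr (1 - m) + k / (1 - q) * t powr (1 - q)" for t
  have up: "\<phi> t \<le> \<phi> T'" if st: "T' \<le> t" for t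
  proof (rule DERIV_nonpos_imp_nonincreasing[OF st])
    fix v assume v: "T' \<le> v" "v \<le> t"
    then have vT: "v \<ge> T" "v \<ge> T1" "v > 0" using T by (auto simp: T'_def)
    have "(\<phi> has_real_derivative f' v + C / (m - 1) * ((1 - m) * v powr (1 - m - 1))
        + k / (1 - q) * ((1 - q) * v powr (1 - q - 1))) (at v)"
      unfolding \<phi>_def using vT
      by (intro DERIV_add DERIV_cmult has_real_derivative_powr deriv) auto
    moreover have "C / (m - 1) * ((1 - m) * v powr (1 - m - 1)) = - (C * v powr (- m))"
      using m by (simp add: field_simps)
    moreover have "k / (1 - q) * ((1 - q) * v powr (1 - q - 1)) = k * v powr (- q)"
      using q by simp
    moreover have "k * v powr (- q) \<le> \<kappa> * v powr (-q) * Q v"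
    proof -
      have "\<kappa> * v powr (-q) * (l / 2) \<le> \<kappa> * v powr (-q) * Q v"
        using \<kappa> T1[OF vT(2)] by (intro mult_left_mono) auto
      then show ?thesis by (simp add: k_def mult_ac)
    qed
    ultimately show "\<exists>y. (\<phi> has_real_derivative y) (at v) \<and> y \<le> 0"
      using le[OF vT(1)] by (intro exI[of _ "f' v - C * v powr (- m) + k * v powr (- q)"]) auto
  qed
  have low: "B + k / (1 - q) * t powr (1 - q) \<le> \<phi> t" if "t \<ge> T'" for t
    using bdd[of t] that C m unfolding \<phi>_def T'_def by (simp add: add_increasing2)
  have ub: "k / (1 - q) * t powr (1 - q) \<le> \<phi> T' - B" if "t \<ge> T'" for t
    using order_trans[OF low[OF that] up[OF that]] by (simp only: le_diff_eq add.commute)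
  have "filterlim (\<lambda>t::real. k / (1 - q) * t powr (1 - q)) at_top at_top"
    using q k by (intro filterlim_tendsto_pos_mult_at_top[OF tendsto_const] powr_pos_at_top) auto
  then have "\<forall>\<^sub>F t in at_top. k / (1 - q) * t powr (1 - q) > \<phi> T' - B"
    by (simp add: filterlim_at_top_dense)
  then have "\<forall>\<^sub>F t::real in at_top. False"
    using eventually_ge_at_top[of T'] by eventually_elim (use ub in fastforce)
  then show False by simp
qed

text \<open>Here \<open>s\<close>, \<open>r\<close>, \<open>\<tau>\<close>, \<open>d\<close> stand
  for \<open>t powr q\<close>, \<open>t powr (q - 1)\<close>, \<open>t powr (- p)\<close> and
  \<open>\<delta> t\<close>, so \<open>q * r\<close> is the derivative of \<open>s\<close>, and
  \<open>v'\<close> is that of \<open>v\<close> along the trajectory. After expansion the products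
  of \<open>xd\<close> with \<open>x\<close>, \<open>D\<close> and \<open>x - z\<close> all
  cancel.\<close>

lemma lyapunov_derivative_identity:
  fixes x xd D z u v v' :: "'a::real_inner"
  assumes s: "s > 0"
    and u: "u = xd + \<beta> *\<^sub>R D"
    and v: "v = b *\<^sub>R (x - z) + s *\<^sub>R u"
    and v': "v' = b *\<^sub>R xd + (q * r) *\<^sub>R u + s *\<^sub>R (- (\<alpha> / s) *\<^sub>R xd - d *\<^sub>R D - (a * \<tau>) *\<^sub>R x)"
  shows "(s\<^sup>2 * d + (\<alpha> - b) * \<beta> * s - 2 * q * \<beta> * s * r) * inner D xd + a * s\<^sup>2 * \<tau> * inner x xd
      + inner v v' + b * (\<alpha> - b - q * r) * inner (x - z) xd
    = b * (q * \<beta> * r - s * d) * inner D (x - z) - (\<alpha> - b - q * r) * s * inner xd xd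
      + (q * \<beta> * r - s * d) * s * \<beta> * inner D D
      - a * b * \<tau> * s * inner x (x - z) - a * \<beta> * s\<^sup>2 * \<tau> * inner x D"
proof -
  define h where "h = x - z"
  have u': "s *\<^sub>R (- (\<alpha> / s) *\<^sub>R xd - d *\<^sub>R D - (a * \<tau>) *\<^sub>R x) = - \<alpha> *\<^sub>R xd - (s * d) *\<^sub>R D - (s * a * \<tau>) *\<^sub>R x"
  proof -
    have *: "s *\<^sub>R (- (\<alpha> / s) *\<^sub>R xd) = - \<alpha> *\<^sub>R xd" using s by simp
    show ?thesis unfolding scaleR_diff_right * by (simp add: mult.assoc)
  qed
  have v'': "v' = (b - \<alpha> + q * r) *\<^sub>R xd + (q * \<beta> * r - s * d) *\<^sub>R D - (a * s * \<tau>) *\<^sub>R x"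
    unfolding v' u' u by (simp add: algebra_simps)
  show ?thesis
    unfolding v'' v u h_def[symmetric]
    by (simp add: inner_simps inner_commute power2_eq_square algebra_simps)
qed

text \<open>The term \<open>b q (1 - q) s / t\<^sup>2 \<parallel>x - z\<parallel>\<^sup>2 / 2\<close> comes from the time dependence of the weight of
  \<open>\<parallel>x - z\<parallel>\<^sup>2\<close>; the Tikhonov term absorbs it by \<open>\<tau>2\<close>, which for \<open>p = 2\<close> is exactly
  \<open>a \<ge> q (1 - q)\<close>.\<close>

lemma lyapunov_derivative_bound:
  fixes x xd D z u :: "'a::real_inner"
  assumes pos: "a > 0" "\<beta> > 0" "b > 0" "b < \<alpha>" "0 < q" "q < 1" "2 * q < p" "K > 0"
    and u: "u = xd + \<beta> *\<^sub>R D"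
    and st: "s \<ge> 1" "t \<ge> 1" "d \<ge> 1" "\<tau> > 0" "r = s / t"
    and G: "G \<ge> 0" "G \<le> inner D (x - z)"
    and d': "t * d' \<le> K * d"
    and r1: "(2 + K + \<alpha> * \<beta> + 2 * \<beta> + b * \<beta>) * r \<le> b / 2"
    and r2: "r \<le> (\<alpha> - b) / 2" and r3: "\<beta> * r \<le> 1 / 4"
    and \<tau>1: "a * \<beta> * (s * \<tau>) \<le> b / 2" and \<tau>2: "q * (1 - q) / t\<^sup>2 \<le> a * \<tau>"
    and \<kappa>: "0 < \<kappa>" "\<kappa> \<le> b / 2" "\<kappa> \<le> (\<alpha> - b) / 4" "\<kappa> \<le> 1 / (4 * \<beta>)"
  shows "(2 * q * s * r * d + s\<^sup>2 * d' + (\<alpha> - b) * \<beta> * q * r - 2 * q * \<beta> * (2 * q - 1) * (r * r)) * G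
      + a / 2 * ((2 * q - p) * s * r * \<tau>) * inner x x
      + b * q * (1 - q) * (s / t\<^sup>2) / 2 * inner (x - z) (x - z)
      + (b * (q * \<beta> * r - s * d) * inner D (x - z) - (\<alpha> - b - q * r) * s * inner xd xd
      + (q * \<beta> * r - s * d) * s * \<beta> * inner D D
      - a * b * \<tau> * s * inner x (x - z) - a * \<beta> * s\<^sup>2 * \<tau> * inner x D)
    \<le> a * b / 2 * inner z z * (s * \<tau>) - \<kappa> * (s * d * G + s * inner u u)"
proof -
  define P where "P = s * d"
  have r0: "r \<ge> 0" using st by simp
  have P1: "P \<ge> 1" and sP: "s \<le> P" using st by (auto simp: P_def intro: order_trans[of _ s] mult_le_cancel_left1)
  have rs: "r \<le> s" using st by (simp add: divide_le_eq mult_le_cancel_left1)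
  have rP: "r \<le> r * P" using mult_left_mono[OF P1 r0] by simp
  have q\<beta>r: "q * \<beta> * r \<le> \<beta> * r" using pos r0 by (simp add: mult_right_mono)
  have \<alpha>\<beta>: "\<alpha> * \<beta> > 0" "b * \<beta> > 0" using pos by auto
  \<comment> \<open>Convexity turns the gradient term into \<open>- b * P * G\<close> up to a small
    correction; half of it absorbs the growth of the weight of \<open>G\<close>, whose terms are all
    bounded by multiples of \<open>r * P\<close>.\<close>
  have t1: "(2 * q * s * r * d + s\<^sup>2 * d' + (\<alpha> - b) * \<beta> * q * r - 2 * q * \<beta> * (2 * q - 1) * (r * r)) * G
      + b * (q * \<beta> * r - s * d) * inner D (x - z) \<le> - (b / 2) * P * G"
  proof -
    have "\<beta> * r \<le> P" using r3 P1 by linarith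
    then have "q * \<beta> * r - P \<le> 0" using q\<beta>r by linarith
    then have "b * (q * \<beta> * r - P) \<le> 0" using pos by (intro mult_nonneg_nonpos) auto
    then have "b * (q * \<beta> * r - P) * inner D (x - z) \<le> b * (q * \<beta> * r - P) * G"
      using G by (intro mult_left_mono_neg) auto
    \<comment> \<open>The bounds \<open>i1\<close> to \<open>i5\<close> account for the five
      summands in \<open>r1\<close>.\<close>
    moreover have "(2 * q * s * r * d + s\<^sup>2 * d' + (\<alpha> - b) * \<beta> * q * r - 2 * q * \<beta> * (2 * q - 1) * (r * r)) * G
       \<le> (b / 2 * P - b * (q * \<beta> * r)) * G"
    proof (rule mult_right_mono[OF _ G(1)])
      have "2 * q * s * r * d = 2 * q * (r * P)" by (simp add: P_def mult_ac)
      also have "\<dots> \<le> 2 * (r * P)" using pos r0 P1 by (intro mult_right_mono) auto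
      finally have i1: "2 * q * s * r * d \<le> 2 * (r * P)" .
      have "s\<^sup>2 * d' = s * r * (t * d')" using st by (simp add: power2_eq_square)
      also have "\<dots> \<le> s * r * (K * d)" using d' st r0 by (intro mult_left_mono) auto
      also have "\<dots> = K * (r * P)" by (simp add: P_def mult_ac)
      finally have i2: "s\<^sup>2 * d' \<le> K * (r * P)" .
      have "(\<alpha> - b) * \<beta> * q * r \<le> \<alpha> * \<beta> * 1 * r"
        using pos r0 by (intro mult_right_mono mult_mono) auto
      also have "\<dots> \<le> \<alpha> * \<beta> * (r * P)" using mult_left_mono[OF rP less_imp_le[OF \<alpha>\<beta>(1)]] by simp
      finally have i3: "(\<alpha> - b) * \<beta> * q * r \<le> \<alpha> * \<beta> * (r * P)" .
      \<comment> \<open>The sign of \<open>2 * q - 1\<close> is open; the bound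
        \<open>q * (1 - 2 * q) \<le> 1\<close> covers both cases.\<close>
      have "- (2 * q * \<beta> * (2 * q - 1) * (r * r)) = 2 * \<beta> * (q * (1 - 2 * q)) * (r * r)"
        by (simp add: algebra_simps)
      also have "\<dots> \<le> 2 * \<beta> * 1 * (r * r)"
      proof (intro mult_right_mono mult_left_mono)
        have "q * (1 - 2 * q) \<le> q" using mult_left_mono[of "1 - 2 * q" 1 q] pos by simp
        then show "q * (1 - 2 * q) \<le> 1" using \<open>q < 1\<close> by linarith
      qed (use pos in auto)
      also have "\<dots> \<le> 2 * \<beta> * (r * P)"
        using rs sP r0 pos by (simp add: mult_left_mono)
      finally have i4: "- (2 * q * \<beta> * (2 * q - 1) * (r * r)) \<le> 2 * \<beta> * (r * P)" .
      have "b * (q * \<beta> * r) \<le> b * (\<beta> * (r * P))"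
        using q\<beta>r rP pos by (smt (verit) mult_left_mono)
      then have i5: "b * (q * \<beta> * r) \<le> b * \<beta> * (r * P)" by simp
      have "(2 + K + \<alpha> * \<beta> + 2 * \<beta> + b * \<beta>) * r * P \<le> b / 2 * P"
        using r1 P1 by (intro mult_right_mono) auto
      then have "2 * (r * P) + K * (r * P) + \<alpha> * \<beta> * (r * P) + 2 * \<beta> * (r * P) + b * \<beta> * (r * P) \<le> b / 2 * P"
        by (simp add: algebra_simps)
      then show "2 * q * s * r * d + s\<^sup>2 * d' + (\<alpha> - b) * \<beta> * q * r - 2 * q * \<beta> * (2 * q - 1) * (r * r)
          \<le> b / 2 * P - b * (q * \<beta> * r)"
        using i1 i2 i3 i4 i5 by linarith
    qed
    ultimately show ?thesis by (simp add: P_def algebra_simps)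
  qed
  have t2: "- ((\<alpha> - b - q * r) * s * inner xd xd) \<le> - ((\<alpha> - b) / 2 * (s * inner xd xd))"
  proof -
    have "q * r \<le> r" using pos r0 by (simp add: mult_left_le_one_le)
    then have "(\<alpha> - b) / 2 \<le> \<alpha> - b - q * r" using r2 by argo
    moreover have "s * inner xd xd \<ge> 0" using st by simp
    ultimately have "(\<alpha> - b) / 2 * (s * inner xd xd) \<le> (\<alpha> - b - q * r) * (s * inner xd xd)"
      by (rule mult_right_mono)
    then show ?thesis by (simp add: mult.assoc)
  qed
  \<comment> \<open>Since \<open>q * \<beta> * r \<le> 1/4 \<le> P / 4\<close>, three quarters of
    the gradient dissipation remain: one quarter pays for \<open>t4\<close>, one half for
    \<open>t9\<close>.\<close>
  have t3: "(q * \<beta> * r - s * d) * s * \<beta> * inner D D \<le> - (3/4 * \<beta> * s * P * inner D D)"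
  proof -
    have "q * \<beta> * r - P \<le> - (3/4) * P" using q\<beta>r r3 P1 by linarith
    then have "(q * \<beta> * r - P) * (s * \<beta> * inner D D) \<le> - (3/4) * P * (s * \<beta> * inner D D)"
      using st pos by (intro mult_right_mono) auto
    then show ?thesis by (simp add: P_def mult_ac)
  qed
  \<comment> \<open>Young's inequality for \<open>inner x D\<close>; by \<open>\<tau>1\<close> the
    remainder in \<open>inner x x\<close> is no more than what \<open>t5\<close> provides.\<close>
  have t4: "- (a * \<beta> * s\<^sup>2 * \<tau> * inner x D) \<le> 1/4 * \<beta> * s * P * inner D D + a * b * \<tau> * s / 2 * inner x x"
  proof -
    have "0 \<le> inner ((1/2) *\<^sub>R D + (a * \<tau>) *\<^sub>R x) ((1/2) *\<^sub>R D + (a * \<tau>) *\<^sub>R x)" by simp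
    then have "- (a * \<tau> * inner x D) \<le> 1/4 * inner D D + (a * \<tau>)\<^sup>2 * inner x x"
      by (simp add: inner_simps inner_commute power2_eq_square algebra_simps)
    then have "\<beta> * s\<^sup>2 * (- (a * \<tau> * inner x D)) \<le> \<beta> * s\<^sup>2 * (1/4 * inner D D + (a * \<tau>)\<^sup>2 * inner x x)"
      using pos by (intro mult_left_mono) auto
    also have "\<dots> = 1/4 * \<beta> * s * s * inner D D + a * (a * \<beta> * (s * \<tau>)) * \<tau> * s * inner x x"
      by (simp add: power2_eq_square algebra_simps)
    also have "\<dots> \<le> 1/4 * \<beta> * s * P * inner D D + a * (b / 2) * \<tau> * s * inner x x"
      using pos st sP \<tau>1 by (intro add_mono mult_right_mono mult_left_mono) auto
    finally show ?thesis by (simp add: mult_ac)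
  qed
  \<comment> \<open>Polarization of the Tikhonov term: the first square cancels the remainder of
    \<open>t4\<close>, the second absorbs \<open>t8\<close>, and the third is the error left in the
    conclusion.\<close>
  have t5: "- (a * b * \<tau> * s * inner x (x - z))
      = - (a * b * \<tau> * s / 2 * inner x x) - a * b * \<tau> * s / 2 * inner (x - z) (x - z) + a * b / 2 * inner z z * (s * \<tau>)"
    by (simp add: inner_simps inner_commute field_simps)
  \<comment> \<open>As \<open>2 * q < p\<close>, the weight of \<open>inner x x\<close> in the
    energy decreases in time.\<close>
  have t7: "a / 2 * ((2 * q - p) * s * r * \<tau>) * inner x x \<le> 0"
    using pos st r0 by (intro mult_nonpos_nonneg mult_nonneg_nonpos) (auto simp: mult_nonpos_nonneg)
  have t8: "b * q * (1 - q) * (s / t\<^sup>2) / 2 * inner (x - z) (x - z) \<le> a * b * \<tau> * s / 2 * inner (x - z) (x - z)"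
  proof (rule mult_right_mono)
    have "b * s / 2 * (q * (1 - q) / t\<^sup>2) \<le> b * s / 2 * (a * \<tau>)"
      using \<tau>2 pos st by (intro mult_left_mono) auto
    then show "b * q * (1 - q) * (s / t\<^sup>2) / 2 \<le> a * b * \<tau> * s / 2" by (simp add: mult_ac)
  qed simp
  \<comment> \<open>\<open>inner u u\<close> is at most twice the sum of the squares of its two
    parts, which are covered by \<open>t2\<close> and by what \<open>t4\<close> leaves of
    \<open>t3\<close>.\<close>
  have t9: "\<kappa> * (s * inner u u) \<le> (\<alpha> - b) / 2 * (s * inner xd xd) + \<beta> / 2 * s * P * inner D D"
  proof -
    have "0 \<le> inner (xd - \<beta> *\<^sub>R D) (xd - \<beta> *\<^sub>R D)" by simp
    then have "inner u u \<le> 2 * inner xd xd + 2 * \<beta>\<^sup>2 * inner D D"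
      unfolding u by (simp add: inner_simps inner_commute power2_eq_square algebra_simps)
    then have "\<kappa> * s * inner u u \<le> \<kappa> * s * (2 * inner xd xd + 2 * \<beta>\<^sup>2 * inner D D)"
      using \<kappa> st by (intro mult_left_mono) auto
    also have "\<dots> = 2 * \<kappa> * (s * inner xd xd) + 2 * \<beta> * (\<kappa> * \<beta>) * s * inner D D"
      by (simp add: power2_eq_square algebra_simps)
    also have "\<dots> \<le> (\<alpha> - b) / 2 * (s * inner xd xd) + 2 * \<beta> * (1 / 4 * P) * s * inner D D"
    proof (intro add_mono mult_right_mono mult_left_mono)
      have "\<kappa> * \<beta> \<le> 1 / 4" using \<kappa>(4) pos by (simp add: field_simps)
      then show "\<kappa> * \<beta> \<le> 1 / 4 * P" using P1 by linarith
    qed (use \<kappa> st pos in auto)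
    finally show ?thesis by (simp add: mult_ac)
  qed
  have t10: "\<kappa> * (s * d * G) \<le> b / 2 * P * G"
  proof -
    have "0 \<le> P * G" using P1 G by simp
    from mult_right_mono[OF \<kappa>(2) this] show ?thesis by (simp only: P_def mult.assoc)
  qed
  have e: "1/4 * \<beta> * s * P * inner D D + \<beta> / 2 * s * P * inner D D = 3/4 * \<beta> * s * P * inner D D"
    by (simp add: algebra_simps)
  have "\<kappa> * (s * d * G + s * inner u u) = \<kappa> * (s * d * G) + \<kappa> * (s * inner u u)"
    by (simp add: algebra_simps)
  then show ?thesis using t1 t2 t3 t4 t5 t7 t8 t9 t10 e by linarith
qed

lemma has_real_derivative_inner_self:
  fixes f :: "real \<Rightarrow> 'a::real_inner"
  assumes "(f has_vector_derivative f') (at t)"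
  shows "((\<lambda>t. inner (f t) (f t)) has_real_derivative 2 * inner (f t) f') (at t)"
  using bounded_bilinear.has_vector_derivative[OF bounded_bilinear_inner assms assms]
  by (simp add: has_real_derivative_iff_has_vector_derivative inner_commute)

text \<open>The objective enters only along the trajectory: \<open>D t\<close> stands for \<open>\<nabla>g (x t)\<close>, \<open>G t\<close> for
  \<open>g (x t) - g z\<close>, and convexity is reduced to \<open>G_le\<close>.\<close>

locale damped_trajectory =
  fixes x xd D :: "real \<Rightarrow> 'a::real_inner" and z :: 'a and G \<delta> \<delta>' :: "real \<Rightarrow> real"
    and t0 \<alpha> \<beta> a p q K :: real
  assumes t0: "t0 > 0"
    and pos: "\<alpha> > 0" "\<beta> > 0" "a > 0" "0 < q" "q < 1" "q + 1 < p" "p \<le> 2" "K > 0"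
    and p2: "p = 2 \<Longrightarrow> q * (1 - q) \<le> a"
    and x_deriv: "\<And>t. t > t0 \<Longrightarrow> (x has_vector_derivative xd t) (at t)"
    and u_deriv: "\<And>t. t > t0 \<Longrightarrow> ((\<lambda>t. xd t + \<beta> *\<^sub>R D t) has_vector_derivative
      - (\<alpha> / t powr q) *\<^sub>R xd t - \<delta> t *\<^sub>R D t - (a * t powr (-p)) *\<^sub>R x t) (at t)"
    and G_deriv: "\<And>t. t > t0 \<Longrightarrow> (G has_real_derivative inner (D t) (xd t)) (at t)"
    and \<delta>_deriv: "\<And>t. t > t0 \<Longrightarrow> (\<delta> has_real_derivative \<delta>' t) (at t)"
    and \<delta>_top: "filterlim \<delta> at_top at_top"
    and K_le: "\<forall>\<^sub>F t in at_top. t * \<delta>' t \<le> K * \<delta> t"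
    and G_nonneg: "\<And>t. t > t0 \<Longrightarrow> 0 \<le> G t"
    and G_le: "\<And>t. t > t0 \<Longrightarrow> G t \<le> inner (D t) (x t - z)"
begin

definition s :: "real \<Rightarrow> real" where "s t = t powr q"
text \<open>For positive \<open>t\<close> this is \<open>t powr (q - 1)\<close>, so that
  \<open>q * r t\<close> is the derivative of \<open>s\<close>.\<close>

definition r :: "real \<Rightarrow> real" where "r t = s t / t"
definition \<tau> :: "real \<Rightarrow> real" where "\<tau> t = t powr (-p)"
text \<open>By \<open>u_deriv\<close> its derivative contains no Hessian.\<close>

definition u :: "real \<Rightarrow> 'a" where "u t = xd t + \<beta> *\<^sub>R D t"
definition v :: "real \<Rightarrow> real \<Rightarrow> 'a" where "v b t = b *\<^sub>R (x t - z) + s t *\<^sub>R u t"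

text \<open>The weights of \<open>G t\<close> and of the last summand are those for which the cross terms
  \<open>\<langle>D t, xd t\<rangle>\<close> and \<open>\<langle>x t - z, xd t\<rangle>\<close> cancel in the derivative.\<close>

definition energy :: "real \<Rightarrow> real \<Rightarrow> real" where
  "energy b t = ((s t)\<^sup>2 * \<delta> t + (\<alpha> - b) * \<beta> * s t - 2 * q * \<beta> * s t * r t) * G t
     + a / 2 * ((s t)\<^sup>2 * \<tau> t) * inner (x t) (x t)
     + inner (v b t) (v b t) / 2
     + b * (\<alpha> - b - q * r t) / 2 * inner (x t - z) (x t - z)"

text \<open>The derivative of \<open>energy b\<close> after the equation of motion has been
  inserted: contributions of the time-dependent weights first, the right-hand side of
  \<open>lyapunov_derivative_identity\<close> in the last bracket.\<close>

definition energy' :: "real \<Rightarrow> real \<Rightarrow> real" where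
  "energy' b t = (2 * q * s t * r t * \<delta> t + (s t)\<^sup>2 * \<delta>' t + (\<alpha> - b) * \<beta> * q * r t
       - 2 * q * \<beta> * (2 * q - 1) * (r t * r t)) * G t
     + a / 2 * ((2 * q - p) * s t * r t * \<tau> t) * inner (x t) (x t)
     + b * q * (1 - q) * (s t / t\<^sup>2) / 2 * inner (x t - z) (x t - z)
     + (b * (q * \<beta> * r t - s t * \<delta> t) * inner (D t) (x t - z)
       - (\<alpha> - b - q * r t) * s t * inner (xd t) (xd t)
       + (q * \<beta> * r t - s t * \<delta> t) * s t * \<beta> * inner (D t) (D t)
       - a * b * \<tau> t * s t * inner (x t) (x t - z) - a * \<beta> * (s t)\<^sup>2 * \<tau> t * inner (x t) (D t))"

section \<open>Derivative of the energy along the trajectory\<close>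

lemma s_pos: "t > 0 \<Longrightarrow> s t > 0"
  by (simp add: s_def)

lemma s_deriv: "t > 0 \<Longrightarrow> (s has_real_derivative q * r t) (at t)"
  using has_real_derivative_powr[of t q] by (simp add: s_def[abs_def] r_def powr_diff)

lemma r_deriv: "t > 0 \<Longrightarrow> (r has_real_derivative (q - 1) * (s t / t\<^sup>2)) (at t)"
  unfolding r_def[abs_def]
  by (rule derivative_eq_intros s_deriv refl | simp add: r_def field_simps power2_eq_square)+

lemma \<tau>_deriv: "t > 0 \<Longrightarrow> (\<tau> has_real_derivative - p * (\<tau> t / t)) (at t)"
  using has_real_derivative_powr[of t "-p"] by (simp add: \<tau>_def[abs_def] powr_diff)

lemma energy_deriv:
  assumes t: "t > t0"
  shows "(energy b has_real_derivative energy' b t) (at t)"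
proof -
  have t': "t > 0" using t t0 by simp
  define v' where "v' = b *\<^sub>R xd t + (q * r t) *\<^sub>R u t
    + s t *\<^sub>R (- (\<alpha> / s t) *\<^sub>R xd t - \<delta> t *\<^sub>R D t - (a * \<tau> t) *\<^sub>R x t)"
  define W where "W t = (s t)\<^sup>2 * \<delta> t + (\<alpha> - b) * \<beta> * s t - 2 * q * \<beta> * s t * r t" for t
  have ud: "(u has_vector_derivative (- (\<alpha> / s t) *\<^sub>R xd t - \<delta> t *\<^sub>R D t - (a * \<tau> t) *\<^sub>R x t)) (at t)"
    using u_deriv[OF t] by (simp add: u_def[abs_def] s_def \<tau>_def)
  have hd: "((\<lambda>t. x t - z) has_vector_derivative xd t) (at t)"
    using has_vector_derivative_diff[OF x_deriv[OF t] has_vector_derivative_const[of z]] by simp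
  have vd: "(v b has_vector_derivative v') (at t)"
    unfolding v_def[abs_def] v'_def
    using has_vector_derivative_add[OF bounded_linear.has_vector_derivative[OF bounded_linear_scaleR_right[of b] hd]
      has_vector_derivative_scaleR[OF s_deriv[OF t'] ud]]
    by (simp add: algebra_simps)
  have Wd: "(W has_real_derivative (2 * q * s t * r t * \<delta> t + (s t)\<^sup>2 * \<delta>' t + (\<alpha> - b) * \<beta> * q * r t
       - 2 * q * \<beta> * (2 * q - 1) * (r t * r t))) (at t)"
  proof -
    have 1: "(W has_real_derivative (2 * s t * (q * r t)) * \<delta> t + (s t)\<^sup>2 * \<delta>' t + (\<alpha> - b) * \<beta> * (q * r t)
       - (2 * q * \<beta> * (q * r t) * r t + 2 * q * \<beta> * s t * ((q - 1) * (s t / t\<^sup>2)))) (at t)"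
      unfolding W_def[abs_def]
      by (rule derivative_eq_intros s_deriv[OF t'] r_deriv[OF t'] \<delta>_deriv[OF t] refl | simp)+
    have 2: "2 * q * \<beta> * s t * ((q - 1) * (s t / t\<^sup>2)) = 2 * q * \<beta> * (q - 1) * (r t * r t)"
      by (simp add: r_def power2_eq_square)
    show ?thesis
      by (rule DERIV_cong[OF 1]) (simp only: 2, simp add: algebra_simps)
  qed
  have Td: "((\<lambda>t. (s t)\<^sup>2 * \<tau> t) has_real_derivative (2 * q - p) * s t * r t * \<tau> t) (at t)"
  proof -
    have "((\<lambda>t. (s t)\<^sup>2 * \<tau> t) has_real_derivative (2 * s t * (q * r t)) * \<tau> t + (s t)\<^sup>2 * (- p * (\<tau> t / t))) (at t)"
      by (rule derivative_eq_intros s_deriv[OF t'] \<tau>_deriv[OF t'] refl | simp)+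
    then show ?thesis
      by (rule DERIV_cong) (simp add: r_def power2_eq_square algebra_simps)
  qed
  have 1: "(energy b has_real_derivative
      ((2 * q * s t * r t * \<delta> t + (s t)\<^sup>2 * \<delta>' t + (\<alpha> - b) * \<beta> * q * r t
       - 2 * q * \<beta> * (2 * q - 1) * (r t * r t)) * G t + inner (D t) (xd t) * W t)
     + (a / 2 * ((2 * q - p) * s t * r t * \<tau> t) * inner (x t) (x t)
        + 2 * inner (x t) (xd t) * (a / 2 * ((s t)\<^sup>2 * \<tau> t)))
     + 2 * inner (v b t) v' / 2
     + (b * (- (q * ((q - 1) * (s t / t\<^sup>2)))) / 2 * inner (x t - z) (x t - z)
        + 2 * inner (x t - z) (xd t) * (b * (\<alpha> - b - q * r t) / 2))) (at t)"
    unfolding energy_def[abs_def] W_def[symmetric]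
    by (intro DERIV_add DERIV_mult DERIV_cmult DERIV_cdivide Wd Td G_deriv t
        has_real_derivative_inner_self x_deriv vd hd)
      (rule derivative_eq_intros r_deriv[OF t'] refl | simp)+
  have 2: "W t * inner (D t) (xd t) + a * (s t)\<^sup>2 * \<tau> t * inner (x t) (xd t)
      + inner (v b t) v' + b * (\<alpha> - b - q * r t) * inner (x t - z) (xd t)
    = b * (q * \<beta> * r t - s t * \<delta> t) * inner (D t) (x t - z) - (\<alpha> - b - q * r t) * s t * inner (xd t) (xd t)
      + (q * \<beta> * r t - s t * \<delta> t) * s t * \<beta> * inner (D t) (D t)
      - a * b * \<tau> t * s t * inner (x t) (x t - z) - a * \<beta> * (s t)\<^sup>2 * \<tau> t * inner (x t) (D t)"
    unfolding W_def
    by (rule lyapunov_derivative_identity[OF s_pos[OF t'] u_def v_def v'_def])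
  \<comment> \<open>A rearrangement with all vector terms abstracted to reals; it matches the
    product-rule form of the derivative with \<open>energy'\<close>.\<close>
  have "(W' * G0 + I * W0) + (T1 * X + 2 * Y * (a / 2 * (s2 * \<tau>0))) + 2 * V / 2
      + (b * (- (q * ((q - 1) * S))) / 2 * H + 2 * J * (b * c / 2))
    = W' * G0 + T1 * X + b * q * (1 - q) * S / 2 * H + (W0 * I + a * s2 * \<tau>0 * Y + V + b * c * J)"
    for W' G0 I W0 T1 X Y s2 \<tau>0 V S H J c :: real
    by (simp add: field_simps)
  then show ?thesis
    by (intro DERIV_cong[OF 1]) (simp only: energy'_def 2[symmetric])
qed

section \<open>Asymptotics of the weights and of the energy\<close>

lemma r_powr: "t > 0 \<Longrightarrow> r t = t powr (q - 1)"
  by (simp add: r_def s_def powr_diff)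

lemma r_tendsto: "(r \<longlongrightarrow> 0) at_top"
proof (rule Lim_transform_eventually)
  show "((\<lambda>t. t powr (q - 1)) \<longlongrightarrow> 0) at_top" using pos by (intro tendsto_powr_minus_at_top) auto
  show "\<forall>\<^sub>F t in at_top. t powr (q - 1) = r t"
    using eventually_gt_at_top[of 0] by eventually_elim (simp add: r_powr)
qed

lemma s_top: "filterlim s at_top at_top"
  unfolding s_def[abs_def] using pos by (intro powr_pos_at_top) auto

lemma s_\<tau>: "s t * \<tau> t = t powr (- (p - q))"
  by (simp add: s_def \<tau>_def powr_add[symmetric])

lemma eventually_large:
  assumes "\<epsilon> > 0"
  shows "\<forall>\<^sub>F t in at_top. t > t0 \<and> t \<ge> 1 \<and> s t \<ge> 1 \<and> \<delta> t \<ge> 1 \<and> 0 \<le> r t \<and> r t \<le> \<epsilon>"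
proof -
  have "\<forall>\<^sub>F t in at_top. s t \<ge> 1" "\<forall>\<^sub>F t in at_top. \<delta> t \<ge> 1"
    using s_top \<delta>_top by (auto simp: filterlim_at_top)
  moreover have "\<forall>\<^sub>F t in at_top. r t < \<epsilon>"
    using order_tendstoD(2)[OF r_tendsto assms] .
  ultimately show ?thesis
    using eventually_gt_at_top[of t0] eventually_ge_at_top[of 1]
    by eventually_elim (auto simp: r_def)
qed

text \<open>For \<open>p = 2\<close> this is \<open>p2\<close>; for \<open>p < 2\<close> the ratio
  \<open>t powr (p - 2)\<close> of the two rates vanishes, so every positive \<open>a\<close>
  suffices.\<close>

lemma eventually_\<tau>: "\<forall>\<^sub>F t in at_top. q * (1 - q) / t\<^sup>2 \<le> a * \<tau> t"
proof (cases "p = 2")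
  case True
  show ?thesis
    using eventually_gt_at_top[of 0]
  proof eventually_elim
    case (elim t)
    have "\<tau> t = t powr (- p)" by (simp only: \<tau>_def)
    also have "\<dots> = t powr (- 2)" by (simp only: True)
    finally have "\<tau> t = 1 / t\<^sup>2" using elim by (simp add: powr_minus_divide powr_numeral)
    then show ?case using p2[OF True] elim by (simp add: divide_right_mono)
  qed
next
  case False
  have "((\<lambda>t::real. q * (1 - q) * t powr (p - 2)) \<longlongrightarrow> q * (1 - q) * 0) at_top"
    using pos False by (intro tendsto_intros tendsto_powr_minus_at_top) auto
  then have "\<forall>\<^sub>F t::real in at_top. q * (1 - q) * t powr (p - 2) < a"
    using pos by (intro order_tendstoD(2)) auto
  then show ?thesis
    using eventually_gt_at_top[of 0]
  proof eventually_elim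
    case (elim t)
    have "q * (1 - q) / t\<^sup>2 = q * (1 - q) * t powr (p - 2) * \<tau> t"
      using elim by (simp add: \<tau>_def powr_diff powr_minus_divide powr_numeral)
    also have "\<dots> \<le> a * \<tau> t" using elim by (intro mult_right_mono) (auto simp: \<tau>_def)
    finally show ?case .
  qed
qed

text \<open>The smallness conditions of \<open>lyapunov_derivative_bound\<close> hold eventually
  because \<open>r t\<close> and \<open>s t * \<tau> t\<close> tend to 0; its condition
  \<open>2 * q < p\<close> follows from \<open>q < 1\<close> and \<open>q + 1 < p\<close>.\<close>

lemma energy_dissipation:
  assumes b: "0 < b" "b < \<alpha>"
  shows "\<exists>\<kappa>>0. \<forall>\<^sub>F t in at_top. energy' b t
    \<le> a * b / 2 * inner z z * t powr (- (p - q)) - \<kappa> * (s t * \<delta> t * G t + s t * inner (u t) (u t))"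
proof -
  define \<kappa> where "\<kappa> = min (b / 2) (min ((\<alpha> - b) / 4) (1 / (4 * \<beta>)))"
  have "0 < \<kappa>" using b pos by (simp add: \<kappa>_def)
  moreover have "\<kappa> \<le> b / 2" "\<kappa> \<le> (\<alpha> - b) / 4" "\<kappa> \<le> 1 / (4 * \<beta>)"
    unfolding \<kappa>_def by (simp_all only: min_le_iff_disj order_refl simp_thms)
  ultimately have \<kappa>: "0 < \<kappa>" "\<kappa> \<le> b / 2" "\<kappa> \<le> (\<alpha> - b) / 4" "\<kappa> \<le> 1 / (4 * \<beta>)" .
  define S where "S = 2 + K + \<alpha> * \<beta> + 2 * \<beta> + b * \<beta>"
  have S: "S > 0" using b pos by (auto simp: S_def intro!: add_pos_pos)
  \<comment> \<open>The least of the three bounds that \<open>r1\<close>, \<open>r2\<close> and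
    \<open>r3\<close> of \<open>lyapunov_derivative_bound\<close> put on \<open>r t\<close>.\<close>
  define \<epsilon> where "\<epsilon> = min (b / 2 / S) (min ((\<alpha> - b) / 2) (1 / (4 * \<beta>)))"
  have "\<epsilon> > 0" using b pos S by (simp add: \<epsilon>_def)
  moreover have "\<epsilon> \<le> b / 2 / S" "\<epsilon> \<le> (\<alpha> - b) / 2" "\<epsilon> \<le> 1 / (4 * \<beta>)"
    unfolding \<epsilon>_def by (simp_all only: min_le_iff_disj order_refl simp_thms)
  ultimately have \<epsilon>: "\<epsilon> > 0" "\<epsilon> \<le> b / 2 / S" "\<epsilon> \<le> (\<alpha> - b) / 2" "\<epsilon> \<le> 1 / (4 * \<beta>)" .
  have "((\<lambda>t. a * \<beta> * (s t * \<tau> t)) \<longlongrightarrow> a * \<beta> * 0) at_top"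
    unfolding s_\<tau> using pos by (intro tendsto_intros tendsto_powr_minus_at_top) auto
  then have "\<forall>\<^sub>F t in at_top. a * \<beta> * (s t * \<tau> t) < b / 2"
    using b by (intro order_tendstoD(2)) auto
  then have "\<forall>\<^sub>F t in at_top. energy' b t
    \<le> a * b / 2 * inner z z * (s t * \<tau> t) - \<kappa> * (s t * \<delta> t * G t + s t * inner (u t) (u t))"
    using eventually_large[OF \<epsilon>(1)] eventually_\<tau> K_le
  proof eventually_elim
    case (elim t)
    have "S * r t \<le> b / 2" using order_trans[of "r t" \<epsilon> "b / 2 / S"] elim \<epsilon> S by (simp add: field_simps)
    moreover have "\<beta> * r t \<le> 1 / 4" using order_trans[of "r t" \<epsilon> "1 / (4 * \<beta>)"] elim \<epsilon> pos by (simp add: field_simps)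
    moreover have "\<tau> t > 0" using elim by (simp add: \<tau>_def)
    ultimately show ?case
      unfolding energy'_def S_def using elim \<epsilon> b pos G_nonneg G_le
      by (intro lyapunov_derivative_bound[where t = t and p = p and K = K and d' = "\<delta>' t"] \<kappa> u_def r_def) auto
  qed
  then show ?thesis using \<kappa>(1) unfolding s_\<tau> by blast
qed

text \<open>Eventually \<open>r t\<close> is so small that the negative correction in the weight of
  \<open>G\<close> costs at most half of \<open>(s t)\<^sup>2 * \<delta> t\<close>, and the one in
  the last weight at most half of \<open>\<alpha> - b\<close>; the other two squares are
  dropped.\<close>

lemma energy_lower_bound:
  assumes b: "0 < b" "b < \<alpha>"
  shows "\<forall>\<^sub>F t in at_top. energy b t \<ge> (s t)\<^sup>2 * \<delta> t * G t / 2 + b * (\<alpha> - b) / 4 * inner (x t - z) (x t - z)"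
proof -
  have "min ((\<alpha> - b) / 2) (1 / (4 * \<beta>)) > 0" using b pos by simp
  from eventually_large[OF this] show ?thesis
  proof eventually_elim
    case (elim t)
    have r: "0 \<le> r t" "r t \<le> (\<alpha> - b) / 2" "\<beta> * r t \<le> 1 / 4" using elim pos by (auto simp: field_simps)
    have G: "G t \<ge> 0" using G_nonneg elim by blast
    have "q * (\<beta> * r t) \<le> 1 * (1 / 4)" using r pos by (intro mult_mono) auto
    then have "2 * s t * (q * (\<beta> * r t)) \<le> 2 * s t * (1 * (1 / 4))"
      using elim by (intro mult_left_mono) auto
    then have "2 * q * \<beta> * s t * r t \<le> s t / 2" by (simp add: mult_ac)
    moreover have "s t \<le> (s t)\<^sup>2 * \<delta> t"
      using elim mult_mono[of 1 "s t" 1 "\<delta> t"] by (simp add: power2_eq_square mult.assoc mult_le_cancel_left1)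
    moreover have "(\<alpha> - b) * \<beta> * s t \<ge> 0" using b pos elim by simp
    ultimately have "(s t)\<^sup>2 * \<delta> t / 2 \<le> (s t)\<^sup>2 * \<delta> t + (\<alpha> - b) * \<beta> * s t - 2 * q * \<beta> * s t * r t"
      by argo
    then have 1: "(s t)\<^sup>2 * \<delta> t / 2 * G t \<le> ((s t)\<^sup>2 * \<delta> t + (\<alpha> - b) * \<beta> * s t - 2 * q * \<beta> * s t * r t) * G t"
      using G by (rule mult_right_mono)
    have "q * r t \<le> r t" using pos r by (simp add: mult_left_le_one_le)
    then have "(\<alpha> - b) / 2 \<le> \<alpha> - b - q * r t" using r by argo
    then have "b / 2 * ((\<alpha> - b) / 2) \<le> b / 2 * (\<alpha> - b - q * r t)" using b by (intro mult_left_mono) auto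
    then have 2: "b * (\<alpha> - b) / 4 * inner (x t - z) (x t - z) \<le> b * (\<alpha> - b - q * r t) / 2 * inner (x t - z) (x t - z)"
      by (intro mult_right_mono) auto
    have 3: "a / 2 * ((s t)\<^sup>2 * \<tau> t) * inner (x t) (x t) \<ge> 0" "inner (v b t) (v b t) / 2 \<ge> 0"
      using pos by (auto simp: \<tau>_def)
    have "(s t)\<^sup>2 * \<delta> t * G t / 2 = (s t)\<^sup>2 * \<delta> t / 2 * G t" by simp
    then show ?case
      unfolding energy_def using add_mono[OF add_mono[OF add_mono[OF 1 3(1)] 3(2)] 2]
      by (simp only: add_0_right)
  qed
qed

text \<open>The energy is affine in \<open>b\<close>, so convergence for two values of \<open>b\<close> gives convergence of
  both coefficients.\<close>

definition energy_const :: "real \<Rightarrow> real" where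
  "energy_const t = ((s t)\<^sup>2 * \<delta> t + \<alpha> * \<beta> * s t - 2 * q * \<beta> * s t * r t) * G t
     + a / 2 * ((s t)\<^sup>2 * \<tau> t) * inner (x t) (x t) + (s t)\<^sup>2 * inner (u t) (u t) / 2"

definition energy_slope :: "real \<Rightarrow> real" where
  "energy_slope t = - \<beta> * (s t * G t) + s t * inner (x t - z) (u t)
     + (\<alpha> - q * r t) / 2 * inner (x t - z) (x t - z)"

text \<open>The \<open>b\<^sup>2\<close> from the square of \<open>v b\<close> cancels the one in
  the last weight.\<close>

lemma energy_affine: "energy b t = energy_const t + b * energy_slope t"
proof -
  have "inner (v b t) (v b t) = b\<^sup>2 * inner (x t - z) (x t - z) + 2 * b * s t * inner (x t - z) (u t)
      + (s t)\<^sup>2 * inner (u t) (u t)"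
    unfolding v_def by (simp add: inner_add_left inner_add_right inner_commute power2_eq_square algebra_simps)
  then show ?thesis
    unfolding energy_def energy_const_def energy_slope_def by (simp add: power2_eq_square field_simps)
qed

lemma energy_eventually:
  assumes b: "0 < b" "b < \<alpha>"
  obtains \<kappa> T where "\<kappa> > 0" "T > 0" "T > t0"
    "\<And>t. t \<ge> T \<Longrightarrow> energy' b t \<le> a * b / 2 * inner z z * t powr (- (p - q))
      - \<kappa> * (s t * \<delta> t * G t + s t * inner (u t) (u t))"
    "\<And>t. t \<ge> T \<Longrightarrow> (s t)\<^sup>2 * \<delta> t * G t / 2 + b * (\<alpha> - b) / 4 * inner (x t - z) (x t - z) \<le> energy b t"
    "\<And>t. t \<ge> T \<Longrightarrow> \<delta> t > 0"
proof -
  obtain \<kappa> where \<kappa>: "\<kappa> > 0" "\<forall>\<^sub>F t in at_top. energy' b t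
    \<le> a * b / 2 * inner z z * t powr (- (p - q)) - \<kappa> * (s t * \<delta> t * G t + s t * inner (u t) (u t))"
    using energy_dissipation[OF b] by blast
  have "\<forall>\<^sub>F t in at_top. t > 0 \<and> t > t0 \<and> energy' b t
      \<le> a * b / 2 * inner z z * t powr (- (p - q)) - \<kappa> * (s t * \<delta> t * G t + s t * inner (u t) (u t))
    \<and> (s t)\<^sup>2 * \<delta> t * G t / 2 + b * (\<alpha> - b) / 4 * inner (x t - z) (x t - z) \<le> energy b t \<and> \<delta> t > 0"
    using \<kappa>(2) energy_lower_bound[OF b] eventually_large[OF zero_less_one]
    by eventually_elim (use t0 in auto)
  then obtain T where "\<And>t. t \<ge> T \<Longrightarrow> t > 0 \<and> t > t0 \<and> energy' b t
      \<le> a * b / 2 * inner z z * t powr (- (p - q)) - \<kappa> * (s t * \<delta> t * G t + s t * inner (u t) (u t))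
    \<and> (s t)\<^sup>2 * \<delta> t * G t / 2 + b * (\<alpha> - b) / 4 * inner (x t - z) (x t - z) \<le> energy b t \<and> \<delta> t > 0"
    unfolding eventually_at_top_linorder by blast
  then show ?thesis using that[of \<kappa> T] \<kappa>(1) by blast
qed

section \<open>Limits of the energy and convergence rates\<close>

lemma energy_tendsto:
  assumes b: "0 < b" "b < \<alpha>"
  shows "\<exists>l. (energy b \<longlongrightarrow> l) at_top"
proof -
  from energy_eventually[OF b] obtain \<kappa> T where T: "\<kappa> > 0" "T > 0" "T > t0"
    "\<And>t. t \<ge> T \<Longrightarrow> energy' b t \<le> a * b / 2 * inner z z * t powr (- (p - q))
      - \<kappa> * (s t * \<delta> t * G t + s t * inner (u t) (u t))"
    "\<And>t. t \<ge> T \<Longrightarrow> (s t)\<^sup>2 * \<delta> t * G t / 2 + b * (\<alpha> - b) / 4 * inner (x t - z) (x t - z) \<le> energy b t"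
    "\<And>t. t \<ge> T \<Longrightarrow> \<delta> t > 0" by metis
  show ?thesis
  proof (rule tendsto_of_deriv_le_integrable[OF T(2)])
    show "1 < p - q" "0 \<le> a * b / 2 * inner z z" using pos b by auto
    fix t assume t: "t \<ge> T"
    have tt: "t > t0" "t > 0" "G t \<ge> 0" "s t > 0" "\<delta> t > 0" using t T G_nonneg by (auto simp: s_def)
    show "(energy b has_real_derivative energy' b t) (at t)" using energy_deriv tt by blast
    have "\<kappa> * (s t * \<delta> t * G t + s t * inner (u t) (u t)) \<ge> 0" using tt T(1) by simp
    then show "energy' b t \<le> a * b / 2 * inner z z * t powr (- (p - q))" using T(4)[OF t] by simp
    have "(s t)\<^sup>2 * \<delta> t * G t / 2 \<ge> 0" "b * (\<alpha> - b) / 4 * inner (x t - z) (x t - z) \<ge> 0" using tt b by auto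
    then show "0 \<le> energy b t" using T(5)[OF t] by (smt (verit))
  qed
qed

lemma energy_coefficients_tendsto:
  shows "\<exists>l. (energy_slope \<longlongrightarrow> l) at_top" "\<exists>l. (energy_const \<longlongrightarrow> l) at_top"
proof -
  \<comment> \<open>With these two values of \<open>b\<close> the slope is the difference of the
    energies times \<open>3 / \<alpha>\<close>, and the constant coefficient is twice the first
    energy minus the second.\<close>
  obtain l1 l2 where l: "(energy (\<alpha> / 3) \<longlongrightarrow> l1) at_top" "(energy (2 * \<alpha> / 3) \<longlongrightarrow> l2) at_top"
    using energy_tendsto[of "\<alpha> / 3"] energy_tendsto[of "2 * \<alpha> / 3"] pos by auto
  have "((\<lambda>t. (energy (2 * \<alpha> / 3) t - energy (\<alpha> / 3) t) * (3 / \<alpha>)) \<longlongrightarrow> (l2 - l1) * (3 / \<alpha>)) at_top"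
    by (intro tendsto_intros l)
  moreover have "(energy (2 * \<alpha> / 3) t - energy (\<alpha> / 3) t) * (3 / \<alpha>) = energy_slope t" for t
    unfolding energy_affine using pos by (simp add: field_simps)
  ultimately show "\<exists>l. (energy_slope \<longlongrightarrow> l) at_top" by auto
  have "((\<lambda>t. 2 * energy (\<alpha> / 3) t - energy (2 * \<alpha> / 3) t) \<longlongrightarrow> 2 * l1 - l2) at_top"
    by (intro tendsto_intros l)
  moreover have "2 * energy (\<alpha> / 3) t - energy (2 * \<alpha> / 3) t = energy_const t" for t
    unfolding energy_affine by (simp add: field_simps)
  ultimately show "\<exists>l. (energy_const \<longlongrightarrow> l) at_top" by auto
qed

text \<open>A convergent energy is eventually bounded, and both summands in
  \<open>energy_lower_bound\<close> are eventually nonnegative.\<close>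

lemma eventually_bounds:
  obtains M where "\<forall>\<^sub>F t in at_top. inner (x t - z) (x t - z) \<le> M" "\<forall>\<^sub>F t in at_top. (s t)\<^sup>2 * \<delta> t * G t \<le> M"
proof -
  define b where "b = \<alpha> / 2"
  have b: "0 < b" "b < \<alpha>" using pos by (auto simp: b_def)
  obtain l where "(energy b \<longlongrightarrow> l) at_top" using energy_tendsto[OF b] by blast
  then have "\<forall>\<^sub>F t in at_top. energy b t < l + 1" by (intro order_tendstoD(2)) auto
  then have *: "\<forall>\<^sub>F t in at_top. (s t)\<^sup>2 * \<delta> t * G t / 2 \<le> l + 1
     \<and> b * (\<alpha> - b) / 4 * inner (x t - z) (x t - z) \<le> l + 1"
    using energy_lower_bound[OF b] eventually_large[OF zero_less_one]
  proof eventually_elim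
    case (elim t)
    have "(s t)\<^sup>2 * \<delta> t * G t / 2 \<ge> 0" "b * (\<alpha> - b) / 4 * inner (x t - z) (x t - z) \<ge> 0"
      using elim G_nonneg[of t] b by auto
    then show ?case using elim by (smt (verit))
  qed
  define c where "c = b * (\<alpha> - b) / 4"
  have c: "c > 0" using b by (simp add: c_def)
  show ?thesis
  proof (rule that)
    show "\<forall>\<^sub>F t in at_top. inner (x t - z) (x t - z) \<le> max (2 * (l + 1)) ((l + 1) / c)"
      using * unfolding c_def[symmetric]
      by eventually_elim (use c in \<open>auto simp: le_max_iff_disj field_simps\<close>)
    show "\<forall>\<^sub>F t in at_top. (s t)\<^sup>2 * \<delta> t * G t \<le> max (2 * (l + 1)) ((l + 1) / c)"
      using * by eventually_elim (auto simp: le_max_iff_disj)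
  qed
qed

text \<open>Divide the bound on \<open>(s t)\<^sup>2 * \<delta> t * G t\<close> by
  \<open>s t\<close> and use \<open>\<delta> t \<ge> 1\<close>. This serves to discard the
  lower-order terms in \<open>G\<close> from the energy.\<close>

lemma s_G_tendsto: "((\<lambda>t. s t * G t) \<longlongrightarrow> 0) at_top"
proof -
  obtain M where M: "\<forall>\<^sub>F t in at_top. (s t)\<^sup>2 * \<delta> t * G t \<le> M" using eventually_bounds by metis
  have "((\<lambda>t. M / s t) \<longlongrightarrow> 0) at_top"
    by (intro tendsto_divide_0[OF tendsto_const] filterlim_at_top_imp_at_infinity s_top)
  then show ?thesis
  proof (rule Lim_null_comparison[rotated])
    show "\<forall>\<^sub>F t in at_top. norm (s t * G t) \<le> M / s t"
      using M eventually_large[OF zero_less_one]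
    proof eventually_elim
      case (elim t)
      have G: "G t \<ge> 0" using G_nonneg elim by blast
      have "(s t)\<^sup>2 * 1 * G t \<le> (s t)\<^sup>2 * \<delta> t * G t"
        using elim G by (intro mult_right_mono mult_left_mono) auto
      also have "\<dots> \<le> M" using elim by blast
      finally have "G t * s t * s t \<le> M" by (simp add: power2_eq_square mult_ac)
      then show ?case using elim G by (simp add: pos_le_divide_eq mult_ac)
    qed
  qed
qed

lemma fast_convergence:
  "((\<lambda>t. (s t)\<^sup>2 * \<delta> t * G t) \<longlongrightarrow> 0) at_top" "((\<lambda>t. (s t)\<^sup>2 * inner (u t) (u t)) \<longlongrightarrow> 0) at_top"
proof -
  define Q where "Q t = (s t)\<^sup>2 * \<delta> t * G t + (s t)\<^sup>2 * inner (u t) (u t) / 2" for t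
  obtain M where M: "\<forall>\<^sub>F t in at_top. inner (x t - z) (x t - z) \<le> M" using eventually_bounds by metis
  obtain l where l: "(energy_const \<longlongrightarrow> l) at_top" using energy_coefficients_tendsto by blast
  \<comment> \<open>The Tikhonov part of the energy vanishes because the trajectory is bounded and
    \<open>2 * q - p < 0\<close>.\<close>
  have X: "((\<lambda>t. (s t)\<^sup>2 * \<tau> t * inner (x t) (x t)) \<longlongrightarrow> 0) at_top"
  proof (rule Lim_null_comparison)
    have "((\<lambda>t::real. t powr (2 * q - p) * (2 * M + 2 * inner z z)) \<longlongrightarrow> 0 * (2 * M + 2 * inner z z)) at_top"
      using pos by (intro tendsto_intros tendsto_powr_minus_at_top) auto
    then show "((\<lambda>t::real. t powr (2 * q - p) * (2 * M + 2 * inner z z)) \<longlongrightarrow> 0) at_top" by simp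
    show "\<forall>\<^sub>F t in at_top. norm ((s t)\<^sup>2 * \<tau> t * inner (x t) (x t)) \<le> t powr (2 * q - p) * (2 * M + 2 * inner z z)"
      using M eventually_gt_at_top[of 0]
    proof eventually_elim
      case (elim t)
      \<comment> \<open>This square is the difference of the two sides of the next
        inequality.\<close>
      have "0 \<le> inner (x t - 2 *\<^sub>R z) (x t - 2 *\<^sub>R z)" by simp
      then have "inner (x t) (x t) \<le> 2 * inner (x t - z) (x t - z) + 2 * inner z z"
        by (simp add: inner_simps inner_commute)
      then have "inner (x t) (x t) \<le> 2 * M + 2 * inner z z" using elim by (smt (verit))
      moreover have "(s t)\<^sup>2 * \<tau> t = t powr (2 * q - p)"
        using elim by (simp add: s_def \<tau>_def power2_eq_square powr_add[symmetric])
      ultimately show ?case by (simp add: mult_left_mono)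
    qed
  qed
  have "((\<lambda>t. energy_const t - (\<alpha> * \<beta> * (s t * G t) - 2 * q * \<beta> * (r t * (s t * G t))
       + a / 2 * ((s t)\<^sup>2 * \<tau> t * inner (x t) (x t)))) \<longlongrightarrow>
       l - (\<alpha> * \<beta> * 0 - 2 * q * \<beta> * (0 * 0) + a / 2 * 0)) at_top"
    by (intro tendsto_intros l s_G_tendsto r_tendsto X)
  moreover have "energy_const t - (\<alpha> * \<beta> * (s t * G t) - 2 * q * \<beta> * (r t * (s t * G t))
       + a / 2 * ((s t)\<^sup>2 * \<tau> t * inner (x t) (x t))) = Q t" for t
    unfolding energy_const_def Q_def by (simp add: algebra_simps)
  ultimately have Ql: "(Q \<longlongrightarrow> l) at_top" by simp
  have b: "0 < \<alpha> / 2" "\<alpha> / 2 < \<alpha>" using pos by auto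
  from energy_eventually[OF b] obtain \<kappa> T where T: "\<kappa> > 0" "T > 0" "T > t0"
    "\<And>t. t \<ge> T \<Longrightarrow> energy' (\<alpha> / 2) t \<le> a * (\<alpha> / 2) / 2 * inner z z * t powr (- (p - q))
      - \<kappa> * (s t * \<delta> t * G t + s t * inner (u t) (u t))"
    "\<And>t. t \<ge> T \<Longrightarrow> (s t)\<^sup>2 * \<delta> t * G t / 2 + (\<alpha> / 2) * (\<alpha> - (\<alpha> / 2)) / 4 * inner (x t - z) (x t - z) \<le> energy (\<alpha> / 2) t"
    "\<And>t. t \<ge> T \<Longrightarrow> \<delta> t > 0" by metis
  \<comment> \<open>Multiplied by \<open>t powr (- q)\<close>, \<open>Q t\<close> is at most the
    dissipated quantity, so a positive limit would exhaust the energy.\<close>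
  have "l \<le> 0"
  proof (rule limit_nonpos_of_dissipation[OF T(2) _ _ _ T(1) _ _ _ Ql])
    show "1 < p - q" "0 \<le> a * (\<alpha> / 2) / 2 * inner z z" "q < 1" using pos by auto
    fix t assume t: "t \<ge> T"
    have tt: "t > t0" "t > 0" "G t \<ge> 0" "s t > 0" "\<delta> t > 0" using t T G_nonneg by (auto simp: s_def)
    show "(energy (\<alpha> / 2) has_real_derivative energy' (\<alpha> / 2) t) (at t)" using energy_deriv tt by blast
    have "t powr (- q) * Q t = s t * \<delta> t * G t + s t * inner (u t) (u t) / 2"
      using tt unfolding Q_def by (simp add: powr_minus s_def field_simps power2_eq_square)
    also have "\<dots> \<le> s t * \<delta> t * G t + s t * inner (u t) (u t)"
      using tt by simp
    finally have "\<kappa> * t powr (- q) * Q t \<le> \<kappa> * (s t * \<delta> t * G t + s t * inner (u t) (u t))"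
      using T(1) by (simp add: mult.assoc)
    then show "energy' (\<alpha> / 2) t \<le> a * (\<alpha> / 2) / 2 * inner z z * t powr (- (p - q)) - \<kappa> * t powr (- q) * Q t"
      using T(4)[OF t] by (smt (verit))
    have "(s t)\<^sup>2 * \<delta> t * G t / 2 \<ge> 0" "(\<alpha> / 2) * (\<alpha> - (\<alpha> / 2)) / 4 * inner (x t - z) (x t - z) \<ge> 0" using tt pos by auto
    then show "0 \<le> energy (\<alpha> / 2) t" using T(5)[OF t] by (smt (verit))
  qed
  have nn: "\<forall>\<^sub>F t in at_top. (s t)\<^sup>2 * \<delta> t * G t \<ge> 0"
    using eventually_large[OF zero_less_one] by eventually_elim (use G_nonneg in auto)
  have "l \<ge> 0"
    by (rule tendsto_lowerbound[OF Ql]) (use nn in \<open>eventually_elim, simp add: Q_def\<close>, simp)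
  with \<open>l \<le> 0\<close> have "l = 0" by (rule antisym)
  then have Q0: "(Q \<longlongrightarrow> 0) at_top" using Ql by simp
  show "((\<lambda>t. (s t)\<^sup>2 * \<delta> t * G t) \<longlongrightarrow> 0) at_top"
    by (rule Lim_null_comparison[OF _ Q0]) (use nn in \<open>eventually_elim, simp add: Q_def\<close>)
  have Q2: "((\<lambda>t. 2 * Q t) \<longlongrightarrow> 0) at_top" using tendsto_mult_left[OF Q0, of 2] by simp
  have "\<forall>\<^sub>F t in at_top. norm ((s t)\<^sup>2 * inner (u t) (u t)) \<le> 2 * Q t"
    using nn by eventually_elim (simp add: Q_def)
  then show "((\<lambda>t. (s t)\<^sup>2 * inner (u t) (u t)) \<longlongrightarrow> 0) at_top"
    using Q2 by (rule Lim_null_comparison)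
qed

lemma velocity_tendsto: "((\<lambda>t. s t * norm (u t)) \<longlongrightarrow> 0) at_top"
proof -
  have "((\<lambda>t. sqrt ((s t)\<^sup>2 * inner (u t) (u t))) \<longlongrightarrow> sqrt 0) at_top"
    by (intro tendsto_real_sqrt fast_convergence)
  moreover have "sqrt ((s t)\<^sup>2 * inner (u t) (u t)) = s t * norm (u t)" for t
    by (simp add: real_sqrt_mult norm_eq_sqrt_inner s_def)
  ultimately show ?thesis by simp
qed

text \<open>Solve \<open>energy_slope\<close> for the squared distance: its other two terms vanish,
  and \<open>\<alpha> - q * r t\<close> tends to \<open>\<alpha> > 0\<close>.\<close>

lemma distance_tendsto: "\<exists>l. ((\<lambda>t. (norm (x t - z))\<^sup>2) \<longlongrightarrow> l) at_top"
proof -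
  obtain M where M: "\<forall>\<^sub>F t in at_top. inner (x t - z) (x t - z) \<le> M" using eventually_bounds by metis
  obtain l where l: "(energy_slope \<longlongrightarrow> l) at_top" using energy_coefficients_tendsto by blast
  have "((\<lambda>t. s t * inner (x t - z) (u t)) \<longlongrightarrow> 0) at_top"
  proof (rule Lim_null_comparison)
    have "((\<lambda>t. sqrt M * (s t * norm (u t))) \<longlongrightarrow> sqrt M * 0) at_top"
      by (intro tendsto_intros velocity_tendsto)
    then show "((\<lambda>t. sqrt M * (s t * norm (u t))) \<longlongrightarrow> 0) at_top" by simp
    show "\<forall>\<^sub>F t in at_top. norm (s t * inner (x t - z) (u t)) \<le> sqrt M * (s t * norm (u t))"
      using M
    proof eventually_elim
      case (elim t)
      have "norm (x t - z) \<le> sqrt M" using elim by (simp add: norm_eq_sqrt_inner)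
      then have "\<bar>inner (x t - z) (u t)\<bar> \<le> sqrt M * norm (u t)"
        by (meson Cauchy_Schwarz_ineq2 mult_right_mono norm_ge_zero order_trans)
      then have "s t * \<bar>inner (x t - z) (u t)\<bar> \<le> s t * (sqrt M * norm (u t))"
        by (intro mult_left_mono) (auto simp: s_def)
      then show ?case by (simp add: abs_mult s_def mult_ac)
    qed
  qed
  then have lim: "((\<lambda>t. (energy_slope t - (- \<beta> * (s t * G t) + s t * inner (x t - z) (u t))) * 2 / (\<alpha> - q * r t))
      \<longlongrightarrow> (l - (- \<beta> * 0 + 0)) * 2 / (\<alpha> - q * 0)) at_top"
    using pos by (intro tendsto_intros l s_G_tendsto r_tendsto) auto
  have eq: "\<forall>\<^sub>F t in at_top. (energy_slope t - (- \<beta> * (s t * G t) + s t * inner (x t - z) (u t))) * 2 / (\<alpha> - q * r t)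
      = (norm (x t - z))\<^sup>2"
  proof -
    have "((\<lambda>t. q * r t) \<longlongrightarrow> q * 0) at_top" by (intro tendsto_intros r_tendsto)
    then have "\<forall>\<^sub>F t in at_top. q * r t < \<alpha>" using pos by (intro order_tendstoD(2)) auto
    then show ?thesis
      by eventually_elim (simp add: energy_slope_def power2_norm_eq_inner)
  qed
  from Lim_transform_eventually[OF lim eq] show ?thesis by blast
qed

end

section \<open>Convergence of trajectories\<close>

lemma convex_sublevel:
  fixes g :: "'a::real_vector \<Rightarrow> real"
  assumes "convex_on UNIV g"
  shows "convex {y. g y \<le> c}"
  unfolding convex_alt
proof (intro ballI allI impI)
  fix y z and \<mu> :: real
  assume *: "y \<in> {y. g y \<le> c}" "z \<in> {y. g y \<le> c}" "0 \<le> \<mu> \<and> \<mu> \<le> 1"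
  have "g ((1 - \<mu>) *\<^sub>R y + \<mu> *\<^sub>R z) \<le> (1 - \<mu>) * g y + \<mu> * g z"
    using convex_onD[OF assms, of \<mu> y z] * by simp
  also have "\<dots> \<le> c" using * by (intro convex_bound_le) auto
  finally show "(1 - \<mu>) *\<^sub>R y + \<mu> *\<^sub>R z \<in> {y. g y \<le> c}" by simp
qed

text \<open>Stands in for weak lower semicontinuity: a sublevel set of \<open>g\<close> is closed
  and convex, so it contains the closed convex hull of any tail lying in it.\<close>

lemma minimizing_closure_hull_tail:
  fixes g :: "'a::real_normed_vector \<Rightarrow> real"
  assumes g: "convex_on UNIV g" "continuous_on UNIV g"
    and lim: "(\<lambda>n. g (y n)) \<longlonglongrightarrow> m" and w: "\<And>n. w \<in> closure (convex hull (y ` {n..}))"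
  shows "g w \<le> m"
proof (rule field_le_epsilon)
  fix e :: real assume "e > 0"
  then have "\<forall>\<^sub>F n in sequentially. g (y n) < m + e"
    by (intro order_tendstoD(2)[OF lim]) simp
  then obtain N where N: "\<And>n. n \<ge> N \<Longrightarrow> g (y n) < m + e"
    by (auto simp: eventually_sequentially)
  have "closure (convex hull (y ` {N..})) \<subseteq> {y. g y \<le> m + e}"
  proof (intro closure_minimal hull_minimal convex_sublevel g)
    show "y ` {N..} \<subseteq> {y. g y \<le> m + e}" using N by (auto intro: less_imp_le)
    show "closed {y. g y \<le> m + e}"
      using g(2) by (intro closed_Collect_le continuous_on_const)
  qed
  then show "g w \<le> m + e" using w[of N] by blast
qed

lemma argmin_iff: "z \<in> argmin g \<longleftrightarrow> (\<forall>y. g z \<le> g y)"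
  for g :: "'a \<Rightarrow> real"
  by (auto simp: argmin_def is_arg_min_def not_less)

text \<open>Almost everywhere the equation writes the derivative of the velocity as a continuous
  \<open>r\<close> minus the derivative of \<open>\<beta> *\<^sub>R grad g (x t)\<close>, which is
  the situation of \<open>abs_continuous_plus_differentiable_has_vector_derivative\<close>. Taking
  \<open>t > t0\<close> makes the derivatives two-sided.\<close>

lemma global_solution_regular:
  fixes g :: "'a::{real_inner, complete_space} \<Rightarrow> real"
  assumes g: "twice_differentiable g" and t0: "t0 > 0" and \<delta>: "continuous_on {t0..} \<delta>"
    and sol: "global_solution t0 \<alpha> q \<beta> a p \<delta> g u0 v0 x" and t: "t > t0"
  shows "(x has_vector_derivative dot t0 x t) (at t)"
    and "((\<lambda>t. dot t0 x t + \<beta> *\<^sub>R grad g (x t)) has_vector_derivative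
      - (\<alpha> / t powr q) *\<^sub>R dot t0 x t - \<delta> t *\<^sub>R grad g (x t) - (a * t powr (-p)) *\<^sub>R x t) (at t)"
proof -
  define y where "y = dot t0 x"
  define r where "r t = - (\<alpha> / t powr q) *\<^sub>R y t - \<delta> t *\<^sub>R grad g (x t) - (a / t powr p) *\<^sub>R x t" for t
  have within: "at t within {t0..} = at t"
    using t by (intro at_within_interior) simp
  have x: "(x has_vector_derivative y s) (at s within {t0..})" if "s \<ge> t0" for s
    using sol that unfolding global_solution_def y_def dot_def by (simp add: vector_derivative_works)
  have ac: "locally_abs_continuous_from t0 y"
    using sol unfolding global_solution_def y_def by blast
  obtain N where N: "negligible N" and ode: "\<And>s. s \<ge> t0 \<Longrightarrow> s \<notin> N \<Longrightarrow>
     y differentiable (at s within {t0..}) \<and> dot t0 y s + (\<alpha> / s powr q) *\<^sub>R y s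
          + \<beta> *\<^sub>R hessian g (x s) (y s) + \<delta> s *\<^sub>R grad g (x s) + (a / s powr p) *\<^sub>R x s = 0"
  proof -
    have "AE s in lebesgue. s \<ge> t0 \<longrightarrow> y differentiable (at s within {t0..}) \<and>
        dot t0 y s + (\<alpha> / s powr q) *\<^sub>R y s
          + \<beta> *\<^sub>R hessian g (x s) (y s) + \<delta> s *\<^sub>R grad g (x s) + (a / s powr p) *\<^sub>R x s = 0"
      using sol unfolding global_solution_def y_def by blast
    then obtain N where "N \<in> null_sets lebesgue" "{s \<in> space lebesgue. \<not> (s \<ge> t0 \<longrightarrow> y differentiable (at s within {t0..}) \<and>
        dot t0 y s + (\<alpha> / s powr q) *\<^sub>R y s
          + \<beta> *\<^sub>R hessian g (x s) (y s) + \<delta> s *\<^sub>R grad g (x s) + (a / s powr p) *\<^sub>R x s = 0)} \<subseteq> N"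
      unfolding eventually_ae_filter by blast
    then show ?thesis using that[of N] by (auto simp: negligible_iff_null_sets)
  qed
  have d: "((\<lambda>s. \<beta> *\<^sub>R grad g (x s)) has_vector_derivative \<beta> *\<^sub>R hessian g (x s) (y s)) (at s within {t0..})"
    if "s \<ge> t0" for s
  proof -
    have "(grad g \<circ> x has_vector_derivative hessian g (x s) (y s)) (at s within {t0..})"
      using vector_derivative_diff_chain_within[OF x[OF that]
          has_derivative_at_withinI[OF twice_differentiable_grad(2)[OF g]]] .
    then show ?thesis
      using bounded_linear.has_vector_derivative[OF bounded_linear_scaleR_right[of \<beta>]] by (auto simp: comp_def)
  qed
  have cx: "continuous_on {t0..} x"
    using x by (auto simp: continuous_on_eq_continuous_within intro: has_vector_derivative_continuous)
  have cg: "continuous_on UNIV (grad g)"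
    using has_derivative_continuous[OF twice_differentiable_grad(2)[OF g]]
    by (simp add: continuous_on_eq_continuous_at)
  have cgx: "continuous_on {t0..} (\<lambda>s. grad g (x s))"
    by (rule continuous_on_compose2[OF cg cx]) simp
  have cr: "continuous_on {t0..} r"
    unfolding r_def[abs_def] using t0
    by (intro continuous_intros \<delta> cgx cx locally_abs_continuous_from_imp_continuous_on[OF ac]) auto
  have y: "(y has_vector_derivative (r s - \<beta> *\<^sub>R hessian g (x s) (y s))) (at s within {t0..})"
    if "s \<ge> t0" "s \<notin> N" for s
  proof -
    have "(y has_vector_derivative dot t0 y s) (at s within {t0..})"
      using ode[OF that] unfolding dot_def by (simp add: vector_derivative_works)
    moreover have "dot t0 y s = r s - \<beta> *\<^sub>R hessian g (x s) (y s)"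
      using ode[OF that] unfolding r_def
      by (simp add: algebra_simps eq_neg_iff_add_eq_0)
    ultimately show ?thesis by simp
  qed
  show "(x has_vector_derivative dot t0 x t) (at t)"
    using x[of t] t unfolding within y_def by simp
  show "((\<lambda>t. dot t0 x t + \<beta> *\<^sub>R grad g (x t)) has_vector_derivative
      - (\<alpha> / t powr q) *\<^sub>R dot t0 x t - \<delta> t *\<^sub>R grad g (x t) - (a * t powr (-p)) *\<^sub>R x t) (at t)"
    using abs_continuous_plus_differentiable_has_vector_derivative[OF ac d cr N y, of t] t
    unfolding within by (simp add: r_def y_def powr_minus_divide)
qed

theorem theorem3p3:
  fixes g :: "'a::{real_inner, complete_space} \<Rightarrow> real"
    and \<delta> \<delta>' :: "real \<Rightarrow> real"
    and t0 \<alpha> \<beta> a p q :: real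
    and u0 v0 :: 'a
    and x :: "real \<Rightarrow> 'a"
  assumes "convex_on UNIV g"
    and "twice_differentiable g"
    and "argmin g \<noteq> {}"
    and "t0 > 0" and "\<alpha> > 0" and "\<beta> > 0" and "a > 0" and "p > 0" and "0 < q" and "q < 1"
    and "\<And>t. t \<ge> t0 \<Longrightarrow> \<delta> t > 0"
    and "\<And>t. t \<ge> t0 \<Longrightarrow> (\<delta> has_real_derivative \<delta>' t) (at t within {t0..})"
    and "mono_on {t0..} \<delta>"
    and "filterlim \<delta> at_top at_top"
    and "q + 1 < p" and "p \<le> 2"
    and "p = 2 \<Longrightarrow> a \<ge> q * (1 - q)"
    and "\<exists>K1>0. \<forall>\<^sub>F t in at_top. t * \<delta>' t < K1 * \<delta> t"
    and "global_solution t0 \<alpha> q \<beta> a p \<delta> g u0 v0 x"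
  shows "(\<exists>z\<in>argmin g. weakly_tendsto x z at_top) \<and>
    (\<forall>z\<in>argmin g.
       (\<lambda>t. g (x t) - g z) \<in> o(\<lambda>t. 1 / (\<delta> t * t powr (2 * q))) \<and>
       (\<lambda>t. norm (dot t0 x t + \<beta> *\<^sub>R grad g (x t))) \<in> o(\<lambda>t. 1 / t powr q))"
proof -
  obtain K where K: "K > 0" "\<forall>\<^sub>F t in at_top. t * \<delta>' t < K * \<delta> t" using assms(18) by blast
  have \<delta>_cont: "continuous_on {t0..} \<delta>"
    using assms(12) by (auto simp: continuous_on_eq_continuous_within intro: DERIV_continuous)
  note regular = global_solution_regular[OF assms(2,4) \<delta>_cont assms(19)]
  note grad = twice_differentiable_grad(1)[OF assms(2)]
  have g_cont: "continuous_on UNIV g"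
    using has_derivative_continuous[OF grad] by (simp add: continuous_on_eq_continuous_at)
  \<comment> \<open>The energy depends on the minimizer \<open>z\<close>, so the analysis is
    instantiated for each one separately.\<close>
  have traj: "damped_trajectory x (dot t0 x) (\<lambda>t. grad g (x t)) z (\<lambda>t. g (x t) - g z) \<delta> \<delta>' t0 \<alpha> \<beta> a p q K"
    if z: "z \<in> argmin g" for z
  proof
    fix t assume t: "t > t0"
    show "(x has_vector_derivative dot t0 x t) (at t)" using regular(1)[OF t] .
    show "((\<lambda>t. dot t0 x t + \<beta> *\<^sub>R grad g (x t)) has_vector_derivative
      - (\<alpha> / t powr q) *\<^sub>R dot t0 x t - \<delta> t *\<^sub>R grad g (x t) - (a * t powr (-p)) *\<^sub>R x t) (at t)"
      using regular(2)[OF t] .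
    have "(x has_derivative (\<lambda>h. h *\<^sub>R dot t0 x t)) (at t)"
      using regular(1)[OF t] by (simp add: has_vector_derivative_def)
    from has_derivative_compose[OF this grad]
    have "((\<lambda>t. g (x t)) has_real_derivative inner (grad g (x t)) (dot t0 x t)) (at t)"
      by (simp add: has_field_derivative_def inner_commute mult.commute[of _ "inner _ _"])
    then show "((\<lambda>t. g (x t) - g z) has_real_derivative inner (grad g (x t)) (dot t0 x t)) (at t)"
      using DERIV_diff[OF _ DERIV_const[of "g z"]] by fastforce
    have "at t within {t0..} = at t" using t by (intro at_within_interior) simp
    then show "(\<delta> has_real_derivative \<delta>' t) (at t)" using assms(12)[of t] t by simp
    show "0 \<le> g (x t) - g z" using z by (simp add: argmin_iff)
    show "g (x t) - g z \<le> inner (grad g (x t)) (x t - z)"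
      by (rule convex_above_gradient[OF assms(1) grad])
  next
    show "\<forall>\<^sub>F t in at_top. t * \<delta>' t \<le> K * \<delta> t" using K(2) by eventually_elim simp
  qed (use assms K in auto)
  have rates: "(\<lambda>t. g (x t) - g z) \<in> o(\<lambda>t. 1 / (\<delta> t * t powr (2 * q)))"
      "(\<lambda>t. norm (dot t0 x t + \<beta> *\<^sub>R grad g (x t))) \<in> o(\<lambda>t. 1 / t powr q)"
      "((\<lambda>t. g (x t)) \<longlongrightarrow> g z) at_top"
      "\<exists>l. ((\<lambda>t. (norm (x t - z))\<^sup>2) \<longlongrightarrow> l) at_top"
    if z: "z \<in> argmin g" for z
  proof -
    interpret damped_trajectory x "dot t0 x" "\<lambda>t. grad g (x t)" z "\<lambda>t. g (x t) - g z" \<delta> \<delta>' t0 \<alpha> \<beta> a p q K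
      by (rule traj[OF z])
    have s2: "(t powr q)\<^sup>2 = t powr (2 * q)" for t
      by (simp add: power2_eq_square powr_add[symmetric])
    show "(\<lambda>t. g (x t) - g z) \<in> o(\<lambda>t. 1 / (\<delta> t * t powr (2 * q)))"
    proof (rule smalloI_tendsto)
      show "((\<lambda>t. (g (x t) - g z) / (1 / (\<delta> t * t powr (2 * q)))) \<longlongrightarrow> 0) at_top"
        using fast_convergence(1) by (simp add: s_def s2 mult_ac)
      show "\<forall>\<^sub>F t in at_top. 1 / (\<delta> t * t powr (2 * q)) \<noteq> 0"
        using eventually_large[OF zero_less_one] by eventually_elim auto
    qed
    show "(\<lambda>t. norm (dot t0 x t + \<beta> *\<^sub>R grad g (x t))) \<in> o(\<lambda>t. 1 / t powr q)"
    proof (rule smalloI_tendsto)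
      show "((\<lambda>t. norm (dot t0 x t + \<beta> *\<^sub>R grad g (x t)) / (1 / t powr q)) \<longlongrightarrow> 0) at_top"
        using velocity_tendsto by (simp add: s_def u_def mult_ac)
      show "\<forall>\<^sub>F t in at_top. 1 / t powr q \<noteq> 0"
        using eventually_gt_at_top[of 0] by eventually_elim auto
    qed
    \<comment> \<open>Eventually \<open>s t \<ge> 1\<close>, so the gap is dominated by the null
      function of \<open>s_G_tendsto\<close>.\<close>
    have "((\<lambda>t. g (x t) - g z) \<longlongrightarrow> 0) at_top"
    proof (rule Lim_null_comparison[OF _ s_G_tendsto])
      show "\<forall>\<^sub>F t in at_top. norm (g (x t) - g z) \<le> s t * (g (x t) - g z)"
        using eventually_large[OF zero_less_one]
      proof eventually_elim
        case (elim t)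
        have "0 \<le> g (x t) - g z" using G_nonneg elim by blast
        then show ?case using elim mult_right_mono[of 1 "s t" "g (x t) - g z"] by simp
      qed
    qed
    then show "((\<lambda>t. g (x t)) \<longlongrightarrow> g z) at_top" by (simp add: LIM_zero_iff)
    show "\<exists>l. ((\<lambda>t. (norm (x t - z))\<^sup>2) \<longlongrightarrow> l) at_top" by (rule distance_tendsto)
  qed
  obtain z0 where z0: "z0 \<in> argmin g" using assms(3) by blast
  have "\<exists>z\<in>argmin g. weakly_tendsto x z at_top"
  proof (rule opial_weakly_tendsto[OF assms(3) rates(4)])
    fix \<sigma> :: "nat \<Rightarrow> real" and w
    assume \<sigma>: "filterlim \<sigma> at_top sequentially" and w: "\<And>n. w \<in> closure (convex hull ((\<lambda>k. x (\<sigma> k)) ` {n..}))"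
    \<comment> \<open>Along any times going to infinity \<open>g (x t)\<close> tends to its minimum,
      so every common point of the hulls is a minimizer.\<close>
    have "g w \<le> g z0"
      by (rule minimizing_closure_hull_tail[OF assms(1) g_cont filterlim_compose[OF rates(3)[OF z0] \<sigma>] w])
    then show "w \<in> argmin g" using z0 unfolding argmin_iff by (meson order_trans)
  qed
  then show ?thesis using rates(1,2) by blast
qed

end
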